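(* For any $n\ge1$, $$\sum_{\sigma\in\mathfrak{S}_n}q^{\mathrm{amaj}_2(\sigma)}p^{\widetilde{\mathrm{asc}_2}(\sigma)}t^{\mathrm{des}(\sigma^{-1})}=\sum_{\sigma\in\mathfrak{S}_n}q^{\mathrm{maj}(\sigma)-\mathrm{exc}(\sigma)}p^{\mathrm{des}(\sigma)}t^{\mathrm{exc}(\sigma)}.$$
   Context: $\mathfrak{S}_n$ is the set of permutations of $\{1,\dots,n\}$, and $q,p,t$ are commuting indeterminates (the identity may be read in the ring of Laurent polynomials with integer coefficients). For $\sigma\in\mathfrak{S}_n$: $\mathrm{DES}(\sigma)=\{i\in\{1,\dots,n-1\}:\sigma(i)>\sigma(i+1)\}$; $\mathrm{des}(\sigma)=|\mathrm{DES}(\sigma)|$; $\mathrm{maj}(\sigma)=\sum_{i\in\mathrm{DES}(\sigma)}i$; $\mathrm{exc}(\sigma)=\#\{i\in\{1,\dots,n\}:\sigma(i)>i\}$; $\mathrm{ASC}_2(\sigma)=\{i\in\{1,\dots,n-1\}:\sigma(i)<\sigma(i+1)-1\}$; $\mathrm{asc}_2(\sigma)=|\mathrm{ASC}_2(\sigma)|$; $\mathrm{amaj}_2(\sigma)=\sum_{i\in\mathrm{ASC}_2(\sigma)}i$; $\widetilde{\mathrm{asc}_2}(\sigma)=\mathrm{asc}_2(\sigma)$ if $\sigma(1)=1$, and $\widetilde{\mathrm{asc}_2}(\sigma)=\mathrm{asc}_2(\sigma)+1$ if $\sigma(1)\ne1$. *)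

theory Defs
  imports "HOL-Combinatorics.Permutations" "HOL-Library.Poly_Mapping" "HOL-Library.Product_Plus"
begin

text \<open>
  A permutation of \<open>{1..n}\<close> is a function \<open>\<sigma> :: nat \<Rightarrow> nat\<close> with \<open>\<sigma> permutes {1..n}\<close>;
  it fixes every point outside \<open>{1..n}\<close>, so \<open>inv \<sigma>\<close> is its inverse in the symmetric group.
\<close>

definition sym_perms :: "nat \<Rightarrow> (nat \<Rightarrow> nat) set" where
  "sym_perms n = {\<sigma>. \<sigma> permutes {1..n}}"

definition DES :: "nat \<Rightarrow> (nat \<Rightarrow> nat) \<Rightarrow> nat set" where
  "DES n \<sigma> = {i \<in> {1..n - 1}. \<sigma> i > \<sigma> (i + 1)}"

definition des :: "nat \<Rightarrow> (nat \<Rightarrow> nat) \<Rightarrow> nat" where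
  "des n \<sigma> = card (DES n \<sigma>)"

definition maj :: "nat \<Rightarrow> (nat \<Rightarrow> nat) \<Rightarrow> nat" where
  "maj n \<sigma> = \<Sum> (DES n \<sigma>)"

definition exc :: "nat \<Rightarrow> (nat \<Rightarrow> nat) \<Rightarrow> nat" where
  "exc n \<sigma> = card {i \<in> {1..n}. \<sigma> i > i}"

text \<open>Truncated subtraction is harmless below: values of \<open>\<sigma>\<close> on \<open>{1..n}\<close> are at least \<open>1\<close>.\<close>

definition ASC2 :: "nat \<Rightarrow> (nat \<Rightarrow> nat) \<Rightarrow> nat set" where
  "ASC2 n \<sigma> = {i \<in> {1..n - 1}. \<sigma> i < \<sigma> (i + 1) - 1}"

definition asc2 :: "nat \<Rightarrow> (nat \<Rightarrow> nat) \<Rightarrow> nat" where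
  "asc2 n \<sigma> = card (ASC2 n \<sigma>)"

definition amaj2 :: "nat \<Rightarrow> (nat \<Rightarrow> nat) \<Rightarrow> nat" where
  "amaj2 n \<sigma> = \<Sum> (ASC2 n \<sigma>)"

definition asc2_tilde :: "nat \<Rightarrow> (nat \<Rightarrow> nat) \<Rightarrow> nat" where
  "asc2_tilde n \<sigma> = (if \<sigma> 1 = 1 then asc2 n \<sigma> else asc2 n \<sigma> + 1)"

text \<open>
  The Laurent polynomial ring in \<open>q, p, t\<close> over the integers: finitely supported functions
  from exponent vectors \<open>(a, b, c)\<close> to coefficients, with the convolution product.
\<close>

type_synonym laurent = "(int \<times> int \<times> int) \<Rightarrow>\<^sub>0 int"

text \<open>\<open>qpt a b c\<close> is the monomial \<open>q\<^sup>a p\<^sup>b t\<^sup>c\<close>, with integer exponents.\<close>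

definition qpt :: "int \<Rightarrow> int \<Rightarrow> int \<Rightarrow> laurent" where
  "qpt a b c = Poly_Mapping.single (a, b, c) 1"

lemma qpt_zero: "qpt 0 0 0 = 1"
  by (simp add: qpt_def flip: zero_prod_def)

lemma qpt_mult: "qpt a b c * qpt a' b' c' = qpt (a + a') (b + b') (c + c')"
  by (simp add: qpt_def mult_single)

lemma qpt_power: "qpt a b c ^ k = qpt (int k * a) (int k * b) (int k * c)"
  by (induction k) (simp_all add: qpt_zero qpt_mult algebra_simps)

lemma qpt_of_nat:
  "qpt (int a) (int b) (int c) = qpt 1 0 0 ^ a * qpt 0 1 0 ^ b * qpt 0 0 1 ^ c"
  by (simp add: qpt_power qpt_mult)

end

(*
  Both sides are expanded over weakly decreasing sequences M = b_0 >= b_1 >= ... >= b_n >= 0 that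
  are strict at the descents (respectively at the positions in ASC_2, and at 0 if sigma(1) <> 1).
  For a set D of forced strict positions the generating function of these sequences depends only
  on |D| and the sum of D, and it is triangular in |D|, so it suffices to compare, for every M,
  the pairs (sigma, b) weighted by q^(sum b) t^ides and by q^(sum b - exc) t^exc.

  Both kinds of pairs are put in bijection with walks on an alphabet of marked and unmarked letters.
  For ASC_2, read the levels b along the values 1, ..., n of sigma and mark a value j whenever j
  stands before j - 1. For excedances, mark the excedances and read the levels along the values;
  this gives a word whose two-line array with its sorted rearrangement is a balanced family of
  exits from each letter. As in Foata's proof of the MacMahon master theorem, following the exits
  from the largest letter yields a closed walk and a balanced family on the remaining letters,
  while cutting a walk at its first largest letter yields a shorter walk and the same closed walks.
*)

theory Submission
  imports Defs "HOL-Library.Product_Lexorder"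
begin

text \<open>A fixed \<open>M\<close> takes over the role of \<open>p\<close>: the exponent of
  \<open>p\<close> becomes a bound on levels, and the words carry only \<open>q\<close> and
  \<open>t\<close>. Permutations are matched together with their sequences and the final
  cancellation is algebraic, so no bijection between the permutations themselves is produced. Each
  level has two letters, the marked one just below the unmarked one. Both readings want this order:
  an excedance, moved one level up, must sort after the unmarked letters of its old level and before
  those of the new one, and a descent of the inverse within one level must not count as a step up.
  Parity also governs the induction on the alphabet. An unmarked letter can be entered from every
  smaller letter, so what follows the first largest letter of a walk can be closed up. A marked
  letter can be entered only from letters at least as large, and as largest letter it must drop out
  of both families. Walks starting at 0 never reach it; for balanced families this is the purpose of
  the condition on last exits.\<close>

section \<open>Walks and balanced families of exits\<close>

text \<open>
  The letter \<open>2 l\<close> stands for an unmarked letter of level \<open>l\<close> and \<open>2 l - 1\<close> for a marked one, which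
  contributes a factor \<open>t\<close>. Going up along a walk produces unmarked letters, going down marked
  ones, and staying on the same level either kind.
\<close>

definition step :: "nat \<Rightarrow> nat \<Rightarrow> bool" where
  "step u a \<longleftrightarrow> (if even a then u \<le> a else a \<le> u)"

primrec walk :: "nat \<Rightarrow> nat list \<Rightarrow> bool" where
  "walk u [] \<longleftrightarrow> True"
| "walk u (a # w) \<longleftrightarrow> step u a \<and> walk a w"

definition walks :: "nat \<Rightarrow> nat list set" where
  "walks N = {w. set w \<subseteq> {..<N} \<and> walk 0 w}"

definition loops :: "nat \<Rightarrow> nat list set" where
  "loops N = {w. set w \<subseteq> {..N} \<and> walk N w \<and> last (N # w) = N}"

text \<open>
  \<open>S u\<close> lists the exits from letter \<open>u\<close> in the order in which a walk consumes them. The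
  balance condition is that of an Eulerian trail from \<open>u\<close> to \<open>N\<close> (\<open>open_stacks N u\<close>) or of a union of
  closed trails (\<open>stacks N\<close>). The condition on the last exit from an odd letter is what remains
  of the requirement that fixed points are not marked as excedances.
\<close>

definition open_stacks :: "nat \<Rightarrow> nat \<Rightarrow> (nat \<Rightarrow> nat list) set" where
  "open_stacks N u = {S.
     (\<forall>x. \<forall>a \<in> set (S x). step x a \<and> a \<le> N) \<and> (\<forall>x > N. S x = []) \<and>
     (\<forall>x. odd x \<longrightarrow> S x \<noteq> [] \<longrightarrow> last (S x) \<noteq> x) \<and>
     (\<forall>a. length (S a) + of_bool (a = N) = (\<Sum>x\<le>N. count_list (S x) a) + of_bool (a = u))}"

definition stacks :: "nat \<Rightarrow> (nat \<Rightarrow> nat list) set" where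
  "stacks N = {S.
     (\<forall>x. \<forall>a \<in> set (S x). step x a \<and> a < N) \<and> (\<forall>x \<ge> N. S x = []) \<and>
     (\<forall>x. odd x \<longrightarrow> S x \<noteq> [] \<longrightarrow> last (S x) \<noteq> x) \<and>
     (\<forall>a. length (S a) = (\<Sum>x<N. count_list (S x) a))}"

text \<open>The walk is recorded from its end backwards, so the head of each stack is the first exit
  taken.\<close>

primrec push :: "nat \<Rightarrow> nat list \<Rightarrow> (nat \<Rightarrow> nat list) \<Rightarrow> nat \<Rightarrow> nat list" where
  "push u [] S = S"
| "push u (a # w) S = (push a w S)(u := a # push a w S u)"

lemmas push_Cons = push.simps(2)

declare push_Cons [simp del]

lemma walk_append: "walk u (v @ w) \<longleftrightarrow> walk u v \<and> walk (last (u # v)) w"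
  by (induction v arbitrary: u) auto

lemma stacks_Suc: "stacks (Suc N) = open_stacks N N"
  unfolding stacks_def open_stacks_def by (auto simp: less_Suc_eq_le lessThan_Suc_atMost Suc_le_eq)

lemma stacks_0: "stacks 0 = {\<lambda>_. []}"
  by (auto simp: stacks_def)

lemma walks_0: "walks 0 = {[]}"
  by (auto simp: walks_def)

lemma sum_count_list_upd:
  fixes u N :: nat
  assumes "u \<le> N"
  shows "(\<Sum>x\<le>N. count_list ((S(u := xs)) x) a) + count_list (S u) a
       = (\<Sum>x\<le>N. count_list (S x) a) + count_list xs (a::nat)"
proof -
  have "(\<Sum>x\<le>N. count_list (T x) a) = count_list (T u) a + (\<Sum>x\<in>{..N} - {u}. count_list (T x) a)" for T :: "nat \<Rightarrow> nat list"
    using assms by (subst sum.remove[of _ u]) auto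
  from this[of S] this[of "S(u := xs)"] show ?thesis by simp
qed

text \<open>Only the last-exit condition at an odd \<open>u\<close> with empty stack is in danger,
  namely if \<open>a = u\<close>. But then the trail recorded so far starts at \<open>u\<close>, and
  since \<open>u\<close> is odd and \<open>N\<close> even, balance requires an exit from
  \<open>u\<close> to be there already.\<close>

lemma open_stacks_push:
  assumes "S \<in> open_stacks N a" "step u a" "a \<le> N" "u \<le> N" "even N"
  shows "S(u := a # S u) \<in> open_stacks N u"
proof -
  have bal: "length (S b) + of_bool (b = N) = (\<Sum>x\<le>N. count_list (S x) b) + of_bool (b = a)" for b
    using assms(1) by (auto simp: open_stacks_def)
  have "last (a # S u) \<noteq> u" if "odd u"
  proof (cases "S u = []")
    case True
    with bal[of u] that \<open>even N\<close> have "u \<noteq> a" by (auto split: if_splits simp: of_bool_def)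
    with True show ?thesis by simp
  next
    case False
    with assms(1) that show ?thesis by (auto simp: open_stacks_def)
  qed
  moreover have "length ((S(u := a # S u)) b) + of_bool (b = N)
      = (\<Sum>x\<le>N. count_list ((S(u := a # S u)) x) b) + of_bool (b = u)" for b
    using bal[of b] sum_count_list_upd[OF \<open>u \<le> N\<close>, of S "a # S u" b]
    by (auto split: if_splits)
  ultimately show ?thesis
    using assms unfolding open_stacks_def by (auto simp del: fun_upd_apply) (auto split: if_splits)
qed

lemma open_stacks_pop:
  assumes "S \<in> open_stacks N u" "S u = a # r" "u \<le> N"
  shows "S(u := r) \<in> open_stacks N a"
proof -
  have bal: "length (S b) + of_bool (b = N) = (\<Sum>x\<le>N. count_list (S x) b) + of_bool (b = u)" for b
    using assms(1) by (auto simp: open_stacks_def)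
  have "length ((S(u := r)) b) + of_bool (b = N)
      = (\<Sum>x\<le>N. count_list ((S(u := r)) x) b) + of_bool (b = a)" for b
    using bal[of b] sum_count_list_upd[OF \<open>u \<le> N\<close>, of S r b] assms(2)
    by (auto split: if_splits)
  moreover have "step x b \<and> b \<le> N" if "b \<in> set ((S(u := r)) x)" for x b
    using assms that unfolding open_stacks_def by (cases "x = u") (auto, (metis list.set_intros)+)
  moreover have "last ((S(u := r)) x) \<noteq> x" if "odd x" "(S(u := r)) x \<noteq> []" for x
    using assms that unfolding open_stacks_def by (cases "x = u") force+
  moreover have "\<forall>x>N. (S(u := r)) x = []"
    using assms unfolding open_stacks_def by auto
  ultimately show ?thesis
    unfolding open_stacks_def by blast
qed

lemma push_mem:
  assumes "walk u w" "set w \<subseteq> {..N}" "last (u # w) = N" "S \<in> open_stacks N N" "u \<le> N" "even N"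
  shows "push u w S \<in> open_stacks N u"
  using assms
proof (induction w arbitrary: u)
  case (Cons a w)
  then have "push a w S \<in> open_stacks N a" by auto
  with Cons.prems show ?case unfolding push_Cons by (intro open_stacks_push) auto
qed simp

text \<open>
  The exits determine the trail: at every letter the next exit is forced, and by balance one can
  only get stuck at \<open>N\<close>.
\<close>

lemma push_inj:
  assumes "last (u # w) = N" "last (u # w') = N" "S N = []" "S' N = []" "push u w S = push u w' S'"
  shows "w = w' \<and> S = S'"
  using assms
proof (induction w arbitrary: u w')
  case Nil
  \<comment> \<open>The empty stack at \<open>N\<close> signals the end of the trail: a nonempty
    walk from \<open>N\<close> would have left an exit on it.\<close>
  then show ?case by (cases w') (auto simp: push_Cons dest: fun_cong[of _ _ u])
next
  case (Cons a w)
  show ?case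
  proof (cases w')
    case Nil
    with Cons.prems show ?thesis by (auto simp: push_Cons dest: fun_cong[of _ _ u])
  next
    case (Cons b v)
    have eq: "(push a w S)(u := a # push a w S u) = (push b v S')(u := b # push b v S' u)"
      using Cons.prems(5) unfolding Cons push_Cons .
    have "a = b" and "push a w S u = push b v S' u"
      using fun_cong[OF eq, of u] by auto
    moreover have "push a w S = push b v S'"
      using eq \<open>push a w S u = push b v S' u\<close> by (metis fun_upd_triv fun_upd_upd)
    ultimately show ?thesis using Cons.IH[of a v] Cons.prems Cons by simp
  qed
qed

lemma push_surj:
  assumes "T \<in> open_stacks N u" "u \<le> N"
  shows "\<exists>w S. walk u w \<and> set w \<subseteq> {..N} \<and> last (u # w) = N \<and> S \<in> open_stacks N N \<and> S N = [] \<and> push u w S = T"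
  using assms
proof (induction "\<Sum>x\<le>N. length (T x)" arbitrary: T u rule: less_induct)
  case less
  show ?case
  proof (cases "T u")
    case Nil
    have "length (T u) + of_bool (u = N) = (\<Sum>x\<le>N. count_list (T x) u) + of_bool (u = u)"
      using less.prems(1) unfolding open_stacks_def by blast
    with Nil have "u = N" by (auto split: if_splits simp: of_bool_def)
    with Nil less.prems show ?thesis by (intro exI[of _ "[]"] exI[of _ T]) auto
  next
    case (Cons a r)
    have a: "step u a" "a \<le> N" using less.prems(1) Cons unfolding open_stacks_def by (auto dest!: spec[of _ u])
    let ?T = "T(u := r)"
    have split: "(\<Sum>x\<le>N. length (S x)) = length (S u) + (\<Sum>x\<in>{..N} - {u}. length (S x))" for S :: "nat \<Rightarrow> nat list"
      using less.prems(2) by (subst sum.remove[of _ u]) auto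
    have "(\<Sum>x\<le>N. length (?T x)) < (\<Sum>x\<le>N. length (T x))"
      using Cons by (subst (1 2) split) simp
    from less.hyps[OF this open_stacks_pop[OF less.prems(1) Cons less.prems(2)] a(2)]
    obtain w S where "walk a w" "set w \<subseteq> {..N}" "last (a # w) = N" "S \<in> open_stacks N N" "S N = []"
        "push a w S = ?T" by blast
    with a Cons show ?thesis by (intro exI[of _ "a # w"] exI[of _ S]) (auto simp: push_Cons fun_upd_idem)
  qed
qed

text \<open>A trail leaves every letter it visits except the final one, hence
  \<open>butlast\<close>.\<close>

lemma length_push:
  "length (push u w S x) = length (S x) + count_list (butlast (u # w)) x"
  by (induction w arbitrary: u) (auto simp: push_Cons)

text \<open>Without exits from \<open>N\<close>, balance at \<open>N\<close> allows no entries into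
  it, so the letter disappears altogether.\<close>

lemma closed_stacks: "{S \<in> open_stacks N N. S N = []} = stacks N"
proof (intro equalityI subsetI)
  fix S assume "S \<in> {S \<in> open_stacks N N. S N = []}"
  then have S: "S \<in> open_stacks N N" "S N = []" by auto
  have bal: "length (S a) = (\<Sum>x\<le>N. count_list (S x) a)" for a
    using S(1) unfolding open_stacks_def by auto
  have "a \<noteq> N" if "a \<in> set (S x)" for a x
  proof -
    have "x \<le> N" using S(1) that unfolding open_stacks_def by (cases "x \<le> N") auto
    moreover have "(\<Sum>x\<le>N. count_list (S x) N) = 0" using bal[of N] S(2) by simp
    ultimately have "count_list (S x) N = 0" by simp
    with that show ?thesis by (auto simp: count_list_0_iff)
  qed
  moreover have "(\<Sum>x\<le>N. count_list (S x) a) = (\<Sum>x<N. count_list (S x) a)" for a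
    using S(2) by (simp flip: lessThan_Suc_atMost)
  ultimately show "S \<in> stacks N"
    using S bal unfolding stacks_def open_stacks_def
    by simp (metis le_neq_implies_less)
next
  fix S assume "S \<in> stacks N"
  moreover have "(\<Sum>x\<le>N. count_list (S x) a) = (\<Sum>x<N. count_list (S x) a)" if "S N = []" for a
    using that by (simp flip: lessThan_Suc_atMost)
  ultimately show "S \<in> {S \<in> open_stacks N N. S N = []}"
    unfolding stacks_def open_stacks_def by (auto intro: less_imp_le)
qed

section \<open>Removing the largest letter\<close>

lemma bij_betw_stacks:
  assumes "even N"
  shows "bij_betw (\<lambda>(w, S). push N w S) (loops N \<times> stacks N) (stacks (Suc N))"
proof -
  have "push N w S \<in> stacks (Suc N)" if "w \<in> loops N" "S \<in> stacks N" for w S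
    using push_mem[of N w N S] that assms closed_stacks[of N]
    by (auto simp: loops_def stacks_Suc)
  moreover have "w = w' \<and> S = S'" if "w \<in> loops N" "S \<in> stacks N" "w' \<in> loops N" "S' \<in> stacks N"
      "push N w S = push N w' S'" for w S w' S'
  proof (rule push_inj[where u = N and N = N])
    show "S N = []" "S' N = []" using that closed_stacks[of N] by auto
  qed (use that in \<open>auto simp: loops_def\<close>)
  moreover have "\<exists>w\<in>loops N. \<exists>S\<in>stacks N. T = push N w S" if "T \<in> stacks (Suc N)" for T
    using push_surj[of T N N] that unfolding closed_stacks[of N, symmetric] loops_def stacks_Suc by blast
  ultimately show ?thesis
    unfolding bij_betw_def inj_on_def image_def by auto
qed

text \<open>An odd largest letter can be entered only from itself, so by balance all its exits would
  be loops. The condition on the last exit rules this out unless there are no exits.\<close>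

lemma stacks_Suc_odd:
  assumes "odd N"
  shows "stacks (Suc N) = stacks N"
proof -
  have "S N = []" if S: "S \<in> open_stacks N N" for S
  proof (rule ccontr)
    assume ne: "S N \<noteq> []"
    have "count_list (S x) N = 0" if "x < N" for x
    proof -
      have "N \<notin> set (S x)" using S that assms unfolding open_stacks_def step_def
        by (metis (no_types, lifting) leD mem_Collect_eq)
      then show ?thesis by simp
    qed
    then have "(\<Sum>x\<le>N. count_list (S x) N) = count_list (S N) N"
      by (simp flip: lessThan_Suc_atMost)
    moreover have "length (S N) = (\<Sum>x\<le>N. count_list (S x) N)"
      using S unfolding open_stacks_def by auto
    ultimately have "count_list (S N) N = length (S N)" by simp
    then have "\<forall>a\<in>set (S N). N = a"
      using length_filter_less[of _ "S N" "(=) N"] unfolding count_list_eq_length_filter by auto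
    with ne have "last (S N) = N" using last_in_set by metis
    with S ne assms show False unfolding open_stacks_def by auto
  qed
  then show ?thesis using closed_stacks[of N] by (auto simp: stacks_Suc)
qed

text \<open>
  A walk is cut at its first visit to the top letter \<open>N\<close>. The remainder \<open>N \<beta>\<close> becomes the closed
  walk \<open>\<beta> N\<close>, which is legal because every letter may step to \<open>N\<close>.
\<close>

lemma bij_betw_walks:
  assumes "even N"
  shows "bij_betw (\<lambda>(w, v). v @ butlast (N # w)) (loops N \<times> walks N) (walks (Suc N))"
proof -
  have rot: "set (butlast (N # w)) \<subseteq> {..N} \<and> walk 0 (v @ butlast (N # w))" 
    if "w \<in> loops N" "v \<in> walks N" for w v
  proof (cases w rule: rev_cases)
    case (snoc \<beta> a)
    have "step (last (0 # v)) N" using that assms by (cases v rule: rev_cases) (auto simp: step_def walks_def)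
    with snoc that show ?thesis by (auto simp: loops_def walks_def walk_append)
  qed (use that in \<open>auto simp: walks_def\<close>)
  have inj: "w = w' \<and> v = v'" if "w \<in> loops N" "v \<in> walks N" "w' \<in> loops N" "v' \<in> walks N"
      "v @ butlast (N # w) = v' @ butlast (N # w')" for w v w' v'
  proof -
    have N: "N \<notin> set v" "N \<notin> set v'" using that by (auto simp: walks_def)
    \<comment> \<open>The cut can be read off: \<open>y\<close> avoids \<open>N\<close>, while
      \<open>butlast (N # x)\<close> is empty or begins with \<open>N\<close>.\<close>
    have tw: "takeWhile (\<lambda>a. a \<noteq> N) (y @ butlast (N # x)) = y \<and> dropWhile (\<lambda>a. a \<noteq> N) (y @ butlast (N # x)) = butlast (N # x)" 
      if "N \<notin> set y" for x y
      using that by (cases x) (auto simp: takeWhile_append dropWhile_append)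
    have "v = v'" "butlast (N # w) = butlast (N # w')" 
      using tw[OF N(1), of w] tw[OF N(2), of w'] that(5) by metis+
    moreover have "N # w = butlast (N # w) @ [N]" "N # w' = butlast (N # w') @ [N]"
      using that append_butlast_last_id[of "N # w"] append_butlast_last_id[of "N # w'"]
      by (simp_all add: loops_def)
    ultimately show ?thesis by (metis list.inject)
  qed
  have surj: "\<exists>w\<in>loops N. \<exists>v\<in>walks N. y = v @ butlast (N # w)" if y: "y \<in> walks (Suc N)" for y
  proof (cases "N \<in> set y")
    case False
    with y have "y \<in> walks N" by (auto simp: walks_def less_Suc_eq)
    then show ?thesis by (intro bexI[of _ "[]"] bexI[of _ y]) (auto simp: loops_def)
  next
    case True
    then obtain v \<beta> where "y = v @ N # \<beta>" "N \<notin> set v" by (meson split_list_first)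
    moreover from this y have "step (last (N # \<beta>)) N" 
      using assms last_in_set[of \<beta>] by (force simp: step_def walks_def less_Suc_eq_le)
    ultimately show ?thesis using y
      by (intro bexI[of _ "\<beta> @ [N]"] bexI[of _ v])
         (auto simp: loops_def walks_def walk_append less_Suc_eq_le butlast_append less_le)
  qed
  have "v @ butlast (N # w) \<in> walks (Suc N)" if "w \<in> loops N" "v \<in> walks N" for w v
    using rot[OF that] that by (auto simp: walks_def less_Suc_eq_le simp del: butlast.simps) 
  with surj have "(\<lambda>(w, v). v @ butlast (N # w)) ` (loops N \<times> walks N) = walks (Suc N)"
    by (fastforce simp del: butlast.simps)
  with inj show ?thesis
    unfolding bij_betw_def inj_on_def by (auto simp del: butlast.simps)
qed

lemma walks_Suc_odd:
  assumes "odd N"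
  shows "walks (Suc N) = walks N"
proof -
  have "N \<notin> set w" if "walk u w" "set w \<subseteq> {..N}" "u < N" for u w
    using that assms
  proof (induction w arbitrary: u)
    case (Cons a w)
    then have "a \<noteq> N" by (auto simp: step_def)
    with Cons.IH[of a] Cons.prems show ?case by auto
  qed simp
  moreover have "0 < N" using assms by (rule odd_pos)
  ultimately show ?thesis by (fastforce simp: walks_def less_Suc_eq)
qed

text \<open>For even \<open>N\<close> both decompositions share the factor \<open>loops N\<close>,
  and the closed walk contributes the letters \<open>butlast (N # w)\<close> on either side. Hence
  the letter counts, on which the weight depends, survive the induction.\<close>

lemma stacks_walks_bij:
  "\<exists>f. bij_betw f (stacks N) (walks N) \<and> (\<forall>S\<in>stacks N. \<forall>x. count_list (f S) x = length (S x))"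
proof (induction N)
  case 0
  show ?case by (rule exI[of _ "\<lambda>_. []"]) (auto simp: stacks_0 walks_0 bij_betw_def)
next
  case (Suc N)
  then obtain f where f: "bij_betw f (stacks N) (walks N)"
    "\<And>S x. S \<in> stacks N \<Longrightarrow> count_list (f S) x = length (S x)" by blast
  show ?case
  proof (cases "even N")
    case False
    with f show ?thesis by (auto simp: stacks_Suc_odd walks_Suc_odd)
  next
    case True
    let ?p = "\<lambda>(w, S). push N w S" and ?q = "\<lambda>(w, v). v @ butlast (N # w)"
    let ?P = "loops N \<times> stacks N"
    let ?g = "the_inv_into ?P ?p"
    let ?F = "?q \<circ> map_prod id f \<circ> ?g"
    have "bij_betw (map_prod id f) ?P (loops N \<times> walks N)"
      using bij_betw_map_prod[OF bij_betw_id f(1)] by blast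
    then have "bij_betw ?F (stacks (Suc N)) (walks (Suc N))"
      by (intro bij_betw_trans[OF bij_betw_the_inv_into[OF bij_betw_stacks[OF True]]]
            bij_betw_trans[OF _ bij_betw_walks[OF True]])
    moreover have "count_list (?F S) x = length (S x)" if "S \<in> stacks (Suc N)" for S x
    proof -
      have g: "?g S \<in> ?P" "?p (?g S) = S"
        using bij_betwE[OF bij_betw_the_inv_into[OF bij_betw_stacks[OF True]]]
          f_the_inv_into_f_bij_betw[OF bij_betw_stacks[OF True]] that by blast+
      obtain w T where wT: "?g S = (w, T)" by (cases "?g S")
      with g have "T \<in> stacks N" "S = push N w T" by auto
      moreover have "?F S = f T @ butlast (N # w)"
        by (simp only: o_apply wT map_prod_simp prod.case id_apply)
      ultimately show ?thesis using f(2)[of T x]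
        by (simp only: length_push count_list_append)
    qed
    ultimately show ?thesis by blast
  qed
qed

section \<open>Rearrangements\<close>

definition below :: "nat list \<Rightarrow> nat \<Rightarrow> nat" where
  "below v u = length (filter (\<lambda>a. a < u) v)"

definition block :: "nat list \<Rightarrow> nat \<Rightarrow> nat list" where
  "block v u = take (below v (Suc u) - below v u) (drop (below v u) v)"

text \<open>
  Below the sorted rearrangement \<open>c\<close> of \<open>v\<close> write \<open>v\<close> itself; \<open>block v u\<close> is the part of \<open>v\<close> below
  the letters \<open>u\<close> of \<open>c\<close>, and \<open>below v u\<close> is its starting position.
\<close>

definition rearrangements :: "nat \<Rightarrow> nat \<Rightarrow> nat list set" where
  "rearrangements n N = {v. length v = n \<and> set v \<subseteq> {..<N} \<and>
     (\<forall>j<n. if odd (v ! j) then below v (v ! j) < j else j < below v (Suc (v ! j)))}"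

lemma below_0: "below v 0 = 0"
  by (simp add: below_def)

lemma below_Suc: "below v (Suc u) = below v u + count_list v u"
  by (induction v) (auto simp: below_def)

lemma below_mono: "u \<le> u' \<Longrightarrow> below v u \<le> below v u'"
  by (induction u' rule: dec_induct) (auto simp: below_Suc)

lemma below_le: "below v u \<le> length v"
  by (simp add: below_def)

lemma below_full: "set v \<subseteq> {..<N} \<Longrightarrow> N \<le> u \<Longrightarrow> below v u = length v"
  unfolding below_def by (subst filter_True) (auto)

lemma length_block: "length (block v u) = count_list v u"
  using below_le[of v "Suc u"] by (auto simp: block_def below_Suc)

lemma nth_block: "i < count_list v u \<Longrightarrow> block v u ! i = v ! (below v u + i)"
  using below_le[of v "Suc u"] by (auto simp: block_def below_Suc)

lemma set_block: "set (block v u) = (!) v ` {below v u..<below v (Suc u)}"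
proof -
  have "set (block v u) = (\<lambda>i. block v u ! i) ` {0..<count_list v u}"
    by (auto simp: set_conv_nth length_block image_def)
  also have "\<dots> = (\<lambda>i. v ! (i + below v u)) ` {0..<count_list v u}"
    by (intro image_cong) (auto simp: nth_block add.commute)
  also have "\<dots> = (!) v ` (\<lambda>i. i + below v u) ` {0..<count_list v u}"
    by (simp only: image_image)
  also have "(\<lambda>i. i + below v u) ` {0..<count_list v u} = {below v u..<below v (Suc u)}"
    by (simp add: below_Suc add.commute)
  finally show ?thesis .
qed

lemma concat_blocks: "concat (map (block v) [0..<N]) = take (below v N) v"
proof (induction N)
  case (Suc N)
  then show ?case by (simp add: block_def below_Suc take_add)
qed (simp add: below_0)

lemma block_containing:
  assumes "j < below v N"
  shows "\<exists>u. below v u \<le> j \<and> j < below v (Suc u)"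
  using assms
proof (induction N)
  case (Suc N)
  then show ?case by (cases "j < below v N") (auto simp: not_less)
qed (simp add: below_0)

lemma count_list_concat: "count_list (concat xss) a = (\<Sum>xs\<leftarrow>xss. count_list xs a)"
  by (induction xss) auto

lemma count_list_rev: "count_list (rev xs) a = count_list xs a"
  by (induction xs) auto

lemma count_list_concat_blocks:
  "count_list (concat (map f [0..<N])) a = (\<Sum>u<N. count_list (f u) (a::nat))"
  by (simp add: count_list_concat comp_def interv_sum_list_conv_sum_set_nat atLeast0LessThan)

text \<open>Comparing a position with block boundaries amounts to comparing the letter standing
  there with the sorted letter above it. For an odd letter inside its own block the strict
  inequality excludes exactly the first position; reversal turns this into the condition on the last
  exit.\<close>

lemma rearrangements_blocks:
  assumes "v \<in> rearrangements n N"
  shows "(\<lambda>u. rev (block v u)) \<in> stacks N"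
proof -
  have v: "length v = n" "set v \<subseteq> {..<N}"
    "\<And>j. j < n \<Longrightarrow> odd (v ! j) \<Longrightarrow> below v (v ! j) < j"
    "\<And>j. j < n \<Longrightarrow> even (v ! j) \<Longrightarrow> j < below v (Suc (v ! j))"
    using assms by (auto simp: rearrangements_def)
  have "step u a \<and> a < N" if "a \<in> set (block v u)" for u a
  proof -
    from that obtain j where j: "below v u \<le> j" "j < below v (Suc u)" "a = v ! j"
      by (auto simp: set_block)
    then have "j < n" using below_le[of v "Suc u"] v(1) by simp
    then have "a < N" using v(1,2) j(3) nth_mem by fastforce
    moreover have "a \<le> u" if "odd a"
      using v(3)[OF \<open>j < n\<close>] that j below_mono[of "Suc u" a v] by (cases "a \<le> u") auto
    moreover have "u \<le> a" if "even a"
      using v(4)[OF \<open>j < n\<close>] that j below_mono[of "Suc a" u v] by (cases "u \<le> a") auto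
    ultimately show ?thesis by (auto simp: step_def)
  qed
  moreover have "hd (block v u) \<noteq> u" if "odd u" "block v u \<noteq> []" for u
  proof -
    have c: "0 < count_list v u" using that(2) length_block[of v u] by (cases "block v u") auto
    then have "below v u < n" using below_le[of v "Suc u"] v(1) by (simp add: below_Suc)
    from v(3)[OF this] that(1) have "v ! below v u \<noteq> u" by auto
    with that(2) c nth_block[of 0 v u] show ?thesis by (simp add: hd_conv_nth)
  qed
  moreover have "block v u = []" if "N \<le> u" for u
    using below_full[OF v(2) that] by (simp add: block_def)
  moreover have "(\<Sum>x<N. count_list (block v x) a) = length (block v a)" for a
    by (simp add: concat_blocks below_full[OF v(2)] length_block flip: count_list_concat_blocks)
  ultimately show ?thesis
    by (auto simp: stacks_def count_list_rev last_rev)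
qed

lemma count_list_stacks:
  assumes "S \<in> stacks N"
  shows "count_list (concat (map (\<lambda>u. rev (S u)) [0..<N])) a = length (S a)"
  using assms unfolding count_list_concat_blocks by (simp add: count_list_rev stacks_def)

lemma below_stacks:
  assumes "S \<in> stacks N"
  shows "below (concat (map (\<lambda>u. rev (S u)) [0..<N])) u = (\<Sum>a<u. length (S a))"
  by (induction u) (simp_all add: below_0 below_Suc count_list_stacks[OF assms])

lemma block_stacks:
  assumes "S \<in> stacks N"
  shows "block (concat (map (\<lambda>u. rev (S u)) [0..<N])) u = rev (S u)"
proof -
  let ?v = "concat (map (\<lambda>u. rev (S u)) [0..<N])"
  have len: "length (concat (map (\<lambda>u. rev (S u)) [0..<k])) = (\<Sum>a<k. length (S a))" for k
    by (induction k) auto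
  show ?thesis
  proof (cases "u < N")
    case True
    then have "[0..<N] = [0..<u] @ u # [Suc u..<N]"
      using upt_add_eq_append[of 0 u "N - u"] by (simp add: upt_conv_Cons)
    then have "?v = concat (map (\<lambda>u. rev (S u)) [0..<u]) @ rev (S u) @ concat (map (\<lambda>u. rev (S u)) [Suc u..<N])"
      by simp
    moreover have "below ?v (Suc u) = below ?v u + length (S u)" "below ?v u = (\<Sum>a<u. length (S a))"
      using below_stacks[OF assms] by simp_all
    ultimately show ?thesis unfolding block_def by (simp add: len)
  next
    case False
    then have "S u = []" using assms by (auto simp: stacks_def)
    then show ?thesis using length_block[of ?v u] count_list_stacks[OF assms, of u] by simp
  qed
qed

lemma stacks_rearrangement:
  assumes "S \<in> stacks N"
  shows "concat (map (\<lambda>u. rev (S u)) [0..<N]) \<in> rearrangements (\<Sum>u<N. length (S u)) N"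
proof -
  let ?v = "concat (map (\<lambda>u. rev (S u)) [0..<N])"
  have S: "\<And>x a. a \<in> set (S x) \<Longrightarrow> step x a" "\<And>x a. a \<in> set (S x) \<Longrightarrow> a < N"
      "\<And>x. odd x \<Longrightarrow> S x \<noteq> [] \<Longrightarrow> last (S x) \<noteq> x"
    using assms by (auto simp: stacks_def)
  have sub: "set ?v \<subseteq> {..<N}" using S(2) by auto
  have len: "length ?v = (\<Sum>u<N. length (S u))"
    using below_full[OF sub, of N] below_stacks[OF assms, of N] by simp
  have "if odd (?v ! j) then below ?v (?v ! j) < j else j < below ?v (Suc (?v ! j))"
    if j: "j < length ?v" for j
  proof -
    obtain u where u: "below ?v u \<le> j" "j < below ?v (Suc u)"
      using block_containing[of j ?v N] below_full[OF sub, of N] j by auto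
    let ?a = "?v ! j"
    have "?a \<in> set (block ?v u)" unfolding set_block using u by auto
    then have a: "?a \<in> set (S u)" unfolding block_stacks[OF assms] by simp
    have pos: "below ?v ?a < below ?v (Suc ?a)"
    proof -
      have "count_list ?v ?a \<noteq> 0" using nth_mem[OF j] by (simp only: count_list_0_iff not_not)
      then show ?thesis by (simp only: below_Suc)
    qed
    show ?thesis
    proof (cases "odd ?a")
      case True
      then have "?a \<le> u" using S(1)[OF a] by (simp add: step_def)
      moreover have "below ?v ?a < j" if "?a < u"
        using below_mono[of "Suc ?a" u ?v] that u pos by linarith
      \<comment> \<open>For a marked letter in its own block only the first position is critical,
        and after the reversal that position holds the last exit.\<close>
      moreover have "below ?v ?a < j" if "?a = u"
      proof (rule ccontr)
        assume "\<not> below ?v ?a < j"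
        moreover have "below ?v ?a = below ?v u" using that by (rule arg_cong)
        ultimately have "j = below ?v u" using u by linarith
        moreover have "0 < count_list ?v u" using pos unfolding that below_Suc by linarith
        ultimately have "?a = hd (block ?v u)"
          using nth_block[of 0 ?v u] length_block[of ?v u]
          by (metis add.right_neutral hd_conv_nth length_greater_0_conv)
        then have "?a = last (S u)" unfolding block_stacks[OF assms] using a by (simp add: hd_rev)
        with S(3)[of u] a True that show False by (metis empty_iff list.set(1))
      qed
      ultimately show ?thesis using True by fastforce
    next
      case False
      then have "u \<le> ?a" using S(1)[OF a] by (simp add: step_def)
      then have "j < below ?v (Suc ?a)" using below_mono[of "Suc u" "Suc ?a" ?v] u(2) by linarith
      with False show ?thesis by presburger
    qed
  qed
  with sub len show ?thesis unfolding rearrangements_def by (simp only: mem_Collect_eq) metis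
qed

lemma bij_betw_blocks:
  "bij_betw (\<lambda>v u. rev (block v u)) (rearrangements n N) {S \<in> stacks N. (\<Sum>u<N. length (S u)) = n}"
proof (rule bij_betw_byWitness[where f' = "\<lambda>S. concat (map (\<lambda>u. rev (S u)) [0..<N])"])
  have id: "concat (map (block v) [0..<N]) = v" if "v \<in> rearrangements n N" for v
    using that below_full[of v N N] by (simp add: concat_blocks rearrangements_def)
  then show "\<forall>v\<in>rearrangements n N. concat (map (\<lambda>u. rev (rev (block v u))) [0..<N]) = v"
    by (simp add: eta_contract_eq)
  show "\<forall>S\<in>{S \<in> stacks N. (\<Sum>u<N. length (S u)) = n}.
      (\<lambda>u. rev (block (concat (map (\<lambda>u. rev (S u)) [0..<N])) u)) = S"
    by (simp add: block_stacks)
  have "(\<Sum>u<N. length (block v u)) = n" if "v \<in> rearrangements n N" for v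
  proof -
    have "(\<Sum>u<N. length (block v u)) = length (concat (map (block v) [0..<N]))"
      by (simp add: length_concat comp_def interv_sum_list_conv_sum_set_nat atLeast0LessThan)
    also have "\<dots> = n" using id[OF that] that by (simp add: rearrangements_def)
    finally show ?thesis .
  qed
  then show "(\<lambda>v u. rev (block v u)) ` rearrangements n N \<subseteq> {S \<in> stacks N. (\<Sum>u<N. length (S u)) = n}"
    using rearrangements_blocks by auto
  show "(\<lambda>S. concat (map (\<lambda>u. rev (S u)) [0..<N])) ` {S \<in> stacks N. (\<Sum>u<N. length (S u)) = n}
      \<subseteq> rearrangements n N"
    using stacks_rearrangement by auto
qed

lemma rearrangements_walks_bij:
  "\<exists>f. bij_betw f (rearrangements n N) {w \<in> walks N. length w = n} \<and>
       (\<forall>v\<in>rearrangements n N. mset (f v) = mset v)"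
proof -
  obtain f where f: "bij_betw f (stacks N) (walks N)"
    and cf: "\<And>S x. S \<in> stacks N \<Longrightarrow> count_list (f S) x = length (S x)"
    using stacks_walks_bij by blast
  let ?F = "{S \<in> stacks N. (\<Sum>u<N. length (S u)) = n}"
  have "length (f S) = (\<Sum>u<N. length (S u))" if "S \<in> stacks N" for S
  proof -
    have "set (f S) \<subseteq> {..<N}" using bij_betwE[OF f] that by (auto simp: walks_def)
    then have "length (f S) = below (f S) N" by (simp add: below_full)
    also have "below (f S) u = (\<Sum>a<u. length (S a))" for u
      by (induction u) (simp_all add: below_0 below_Suc cf[OF that])
    finally show ?thesis .
  qed
  then have "f ` ?F = {w \<in> f ` stacks N. length w = n}"
    by auto
  then have "f ` ?F = {w \<in> walks N. length w = n}"
    using f unfolding bij_betw_def by simp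
  then have "bij_betw f ?F {w \<in> walks N. length w = n}"
    using f by (auto intro: bij_betw_subset)
  from bij_betw_trans[OF bij_betw_blocks this]
  have bij: "bij_betw (f \<circ> (\<lambda>v u. rev (block v u))) (rearrangements n N) {w \<in> walks N. length w = n}" .
  have "mset (f (\<lambda>u. rev (block v u))) = mset v" if "v \<in> rearrangements n N" for v
    using cf[OF rearrangements_blocks[OF that]]
    by (intro multiset_eqI) (simp add: count_mset length_block)
  with bij show ?thesis by auto
qed

section \<open>Sorting permutations\<close>

definition rank :: "nat \<Rightarrow> (nat \<Rightarrow> 'a::linorder) \<Rightarrow> nat \<Rightarrow> nat" where
  "rank n key j = (if j \<in> {1..n} then card {k \<in> {1..n}. key k \<le> key j} else j)"

lemma rank_less:
  assumes "j \<in> {1..n}" "k \<in> {1..n}" "key j < key k"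
  shows "rank n key j < rank n key k"
proof -
  have "{i \<in> {1..n}. key i \<le> key j} \<subset> {i \<in> {1..n}. key i \<le> key k}"
    using assms by (auto intro: order_trans[OF _ less_imp_le] dest: leD)
  from psubset_card_mono[OF _ this] assms(1,2) show ?thesis by (simp add: rank_def)
qed

lemma rank_less_iff:
  assumes "inj_on key {1..n}" "j \<in> {1..n}" "k \<in> {1..n}"
  shows "rank n key j < rank n key k \<longleftrightarrow> key j < key k"
  using rank_less[of j n k key] rank_less[of k n j key] assms
  by (metis inj_onD less_asym linorder_neqE)

lemma rank_permutes:
  assumes "inj_on key {1..n}"
  shows "rank n key permutes {1..n}"
proof (rule bij_imp_permutes)
  have "inj_on (rank n key) {1..n}"
    using rank_less_iff[OF assms] assms by (intro inj_onI) (metis inj_onD less_irrefl linorder_neqE)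
  moreover have "rank n key j \<in> {1..n}" if "j \<in> {1..n}" for j
  proof -
    have "card {k \<in> {1..n}. key k \<le> key j} \<le> card {1..n}" by (intro card_mono) auto
    moreover have "{k \<in> {1..n}. key k \<le> key j} \<noteq> {}" using that by auto
    ultimately show ?thesis using that by (auto simp: rank_def Suc_le_eq card_gt_0_iff)
  qed
  ultimately show "bij_betw (rank n key) {1..n} {1..n}"
    unfolding bij_betw_def by (metis endo_inj_surj finite_atLeastAtMost image_subsetI)
qed (auto simp: rank_def)

text \<open>Decoding principle for both encodings: to identify the result of sorting, it suffices to
  know one permutation that respects the key.\<close>

lemma rank_unique:
  assumes "\<tau> permutes {1..n}" "inj_on key {1..n}"
    and mono: "\<And>j k. j \<in> {1..n} \<Longrightarrow> k \<in> {1..n} \<Longrightarrow> key j < key k \<Longrightarrow> \<tau> j < \<tau> k"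
  shows "rank n key = \<tau>"
proof
  fix j
  show "rank n key j = \<tau> j"
  proof (cases "j \<in> {1..n}")
    case True
    have "key k \<le> key j \<longleftrightarrow> \<tau> k \<le> \<tau> j" if "k \<in> {1..n}" for k
      using mono[OF that True] mono[OF True that] assms(2) True that
      by (metis inj_onD leD le_less not_le order_refl)
    then have "{k \<in> {1..n}. key k \<le> key j} = {k \<in> {1..n}. \<tau> k \<le> \<tau> j}" by auto
    also have "\<dots> = inv \<tau> ` {1..\<tau> j}"
    proof -
      have "k \<in> inv \<tau> ` {1..\<tau> j}" if "k \<in> {1..n}" "\<tau> k \<le> \<tau> j" for k
        using permutes_in_image[OF assms(1), of k] permutes_inverses(2)[OF assms(1), of k] that
        by (intro image_eqI[of _ _ "\<tau> k"]) auto
      moreover have "inv \<tau> i \<in> {1..n}" if "i \<in> {1..\<tau> j}" for i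
        using permutes_in_image[OF permutes_inv[OF assms(1)], of i]
          permutes_in_image[OF assms(1), of j] that True by auto
      ultimately show ?thesis using permutes_inverses(1)[OF assms(1)] by auto
    qed
    finally have "rank n key j = card (inv \<tau> ` {1..\<tau> j})" using True by (simp add: rank_def)
    also have "\<dots> = \<tau> j"
      using permutes_inj_on[OF permutes_inv[OF assms(1)]] by (subst card_image) auto
    finally show ?thesis .
  next
    case False
    then show ?thesis by (simp only: rank_def permutes_not_in[OF assms(1) False] if_False)
  qed
qed

section \<open>Excedances\<close>

text \<open>Compatible sequences in the sense of P-partitions. The value \<open>M\<close> at 0 turns
  position 0 into a possible strict position; the zeros after \<open>n\<close> make a sequence
  determined by finitely many values.\<close>

definition compat :: "nat \<Rightarrow> nat \<Rightarrow> nat set \<Rightarrow> (nat \<Rightarrow> nat) set" where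
  "compat n M D = {b. b 0 = M \<and> (\<forall>i>n. b i = 0) \<and> (\<forall>i<n. b (Suc i) \<le> b i) \<and> (\<forall>i\<in>D. b (Suc i) < b i)}"

lemma compat_antimono:
  assumes "b \<in> compat n M D" "i \<le> j"
  shows "b j \<le> b i"
proof (rule lift_Suc_antimono_le[OF _ assms(2)])
  show "b (Suc i) \<le> b i" for i
    using assms(1) by (cases "i < n") (auto simp: compat_def)
qed

lemma compat_le: "b \<in> compat n M D \<Longrightarrow> b i \<le> M"
  using compat_antimono[of b n M D 0 i] by (simp add: compat_def)

lemma compat_eqI:
  assumes "b \<in> compat n M D" "b' \<in> compat n M D'" "\<And>i. i \<in> {1..n} \<Longrightarrow> M - b i = M - b' i"
  shows "b = b'"
proof
  fix i
  show "b i = b' i"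
  proof (cases "i \<in> {1..n}")
    case True
    then show ?thesis using assms(3)[OF True] compat_le[OF assms(1), of i] compat_le[OF assms(2), of i] by simp
  next
    case False
    then show ?thesis using assms(1,2) by (cases "i = 0") (auto simp: compat_def)
  qed
qed

text \<open>Ties are broken by position, so the \<open>rank\<close> of this key is the
  standardization of the word.\<close>

definition letter_key :: "nat list \<Rightarrow> nat \<Rightarrow> nat \<times> nat" where
  "letter_key v j = (v ! (j - 1), j)"

lemma inj_letter_key: "inj_on (letter_key v) A"
  by (auto simp: letter_key_def inj_on_def)

lemma rank_letter_key:
  assumes "length v = n" "i < n"
  shows "rank n (letter_key v) (Suc i) = below v (v ! i) + card {k. k \<le> i \<and> v ! k = v ! i}"
proof -
  have "{k \<in> {1..n}. letter_key v k \<le> letter_key v (Suc i)}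
      = Suc ` ({k. k < n \<and> v ! k < v ! i} \<union> {k. k \<le> i \<and> v ! k = v ! i})"
  proof -
    have "k \<in> Suc ` K \<longleftrightarrow> 1 \<le> k \<and> k - 1 \<in> K" for k K by (cases k) auto
    then show ?thesis using assms by (auto simp: letter_key_def)
  qed
  then have "rank n (letter_key v) (Suc i) = card ({k. k < n \<and> v ! k < v ! i} \<union> {k. k \<le> i \<and> v ! k = v ! i})"
    using assms by (simp add: rank_def card_image)
  also have "\<dots> = card {k. k < n \<and> v ! k < v ! i} + card {k. k \<le> i \<and> v ! k = v ! i}"
    by (intro card_Un_disjoint) auto
  finally show ?thesis using assms by (simp add: below_def length_filter_conv_card)
qed

lemma below_Suc_conv_card:
  assumes "length v = n" "i < n"
  shows "below v (Suc (v ! i)) = rank n (letter_key v) (Suc i) + card {k. i < k \<and> k < n \<and> v ! k = v ! i}"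
proof -
  have "below v (Suc (v ! i)) = below v (v ! i) + card {k. k < n \<and> v ! k = v ! i}"
    using assms by (simp add: below_Suc count_list_eq_length_filter length_filter_conv_card eq_commute)
  also have "{k. k < n \<and> v ! k = v ! i} = {k. k \<le> i \<and> v ! k = v ! i} \<union> {k. i < k \<and> k < n \<and> v ! k = v ! i}"
    using assms by auto
  also have "card \<dots> = card {k. k \<le> i \<and> v ! k = v ! i} + card {k. i < k \<and> k < n \<and> v ! k = v ! i}"
    by (intro card_Un_disjoint) auto
  finally show ?thesis using rank_letter_key[OF assms] by simp
qed

text \<open>The left side sees only the boundary of a block, the rank also the place within it. The
  gap is closed by using the condition at all copies of a letter: if every copy of an odd letter
  lies strictly after the start of its block, counting the copies up to \<open>i\<close> bounds the
  rank by \<open>i\<close>. For an even letter the copies after \<open>i\<close> are counted against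
  the end of the block.\<close>

lemma rearrangements_iff_rank:
  "v \<in> rearrangements n N \<longleftrightarrow> length v = n \<and> set v \<subseteq> {..<N} \<and>
     (\<forall>j\<in>{1..n}. odd (v ! (j - 1)) \<longleftrightarrow> rank n (letter_key v) j < j)"
  (is "?L \<longleftrightarrow> ?R")
proof
  assume ?L
  then have v: "length v = n" "set v \<subseteq> {..<N}"
    and o: "\<And>j. j < n \<Longrightarrow> odd (v ! j) \<Longrightarrow> below v (v ! j) < j"
    and e: "\<And>j. j < n \<Longrightarrow> even (v ! j) \<Longrightarrow> j < below v (Suc (v ! j))"
    by (auto simp: rearrangements_def)
  have "odd (v ! i) \<longleftrightarrow> rank n (letter_key v) (Suc i) < Suc i" if i: "i < n" for i
  proof (cases "odd (v ! i)")
    case True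
    have "card {k. k \<le> i \<and> v ! k = v ! i} \<le> card {below v (v ! i)<..i}"
    proof (intro card_mono subsetI)
      fix k assume k: "k \<in> {k. k \<le> i \<and> v ! k = v ! i}"
      then show "k \<in> {below v (v ! i)<..i}" using o[of k] True i by auto
    qed simp
    then show ?thesis using True o[OF i True] rank_letter_key[OF v(1) i] by simp
  next
    case False
    have "card {k. i < k \<and> k < n \<and> v ! k = v ! i} \<le> card {i<..<below v (Suc (v ! i))}"
    proof (intro card_mono subsetI)
      fix k assume k: "k \<in> {k. i < k \<and> k < n \<and> v ! k = v ! i}"
      then show "k \<in> {i<..<below v (Suc (v ! i))}" using e[of k] False by auto
    qed simp
    then show ?thesis using False e[OF i] below_Suc_conv_card[OF v(1) i] by simp
  qed
  then have "odd (v ! (j - 1)) \<longleftrightarrow> rank n (letter_key v) j < j" if "j \<in> {1..n}" for j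
    using that by (cases j) auto
  with v show ?R by blast
next
  assume R: ?R
  then have r: "odd (v ! i) \<longleftrightarrow> rank n (letter_key v) (Suc i) < Suc i" if "i < n" for i
    using that by (auto dest: bspec[of _ _ "Suc i"])
  have "below v (v ! i) < i" if "i < n" "odd (v ! i)" for i
  proof -
    have "i \<in> {k. k \<le> i \<and> v ! k = v ! i}" by simp
    then have "0 < card {k. k \<le> i \<and> v ! k = v ! i}" 
      by (subst card_gt_0_iff) auto
    then show ?thesis using r[OF that(1)] that rank_letter_key[of v n i] R by simp
  qed
  moreover have "i < below v (Suc (v ! i))" if "i < n" "even (v ! i)" for i
    using r[OF that(1)] that below_Suc_conv_card[of v n i] R by simp
  ultimately show ?L using R by (simp add: rearrangements_def)
qed

text \<open>
  An excedance at \<open>i\<close> is marked and moved one level up: its letter has level \<open>M - b i + 1\<close>,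
  which accounts for the \<open>- exc\<close> in \<open>maj - exc\<close>.
\<close>

definition exc_code :: "nat \<Rightarrow> (nat \<Rightarrow> nat) \<Rightarrow> (nat \<Rightarrow> nat) \<Rightarrow> nat \<Rightarrow> nat" where
  "exc_code M \<sigma> b i = 2 * (M - b i) + of_bool (i < \<sigma> i)"

definition exc_word :: "nat \<Rightarrow> nat \<Rightarrow> (nat \<Rightarrow> nat) \<Rightarrow> (nat \<Rightarrow> nat) \<Rightarrow> nat list" where
  "exc_word n M \<sigma> b = map (\<lambda>j. exc_code M \<sigma> b (inv \<sigma> j)) [1..<Suc n]"

lemma nth_map_upt1: "j \<in> {1..n} \<Longrightarrow> map f [1..<Suc n] ! (j - 1) = f j"
  by (subst nth_map) (auto simp del: upt_Suc)

lemma strict_chain: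
  fixes f :: "nat \<Rightarrow> 'a::order"
  assumes "\<And>i. i \<in> {1..<n} \<Longrightarrow> f i < f (Suc i)" "i < k" "1 \<le> i" "k \<le> n"
  shows "f i < f k"
  using assms(2,4)
proof (induction k)
  case (Suc k)
  have "f k < f (Suc k)" using Suc.prems assms(3) by (intro assms(1)) auto
  then show ?case using Suc by (cases "i = k") (auto intro: less_trans)
qed simp

lemma sorted_by_key:
  assumes \<sigma>: "\<sigma> permutes {1..n}"
    and mono: "\<And>i k. i \<in> {1..n} \<Longrightarrow> k \<in> {1..n} \<Longrightarrow> i < k \<Longrightarrow> key (\<sigma> i) < (key (\<sigma> k) :: 'a::linorder)"
    and "inj_on key {1..n}"
  shows "rank n key = inv \<sigma>"
proof (rule rank_unique[OF permutes_inv[OF \<sigma>] assms(3)])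
  fix j k assume jk: "j \<in> {1..n}" "k \<in> {1..n}" "key j < key k"
  have "inv \<sigma> j \<in> {1..n}" "inv \<sigma> k \<in> {1..n}"
    using jk permutes_in_image[OF permutes_inv[OF \<sigma>]] by blast+
  with mono[of "inv \<sigma> k" "inv \<sigma> j"] jk show "inv \<sigma> j < inv \<sigma> k"
    unfolding permutes_inverses(1)[OF \<sigma>]
    by (metis less_asym less_irrefl linorder_neqE_nat permutes_inverses(1)[OF \<sigma>])
qed

text \<open>A drop of \<open>b\<close> raises the level and with it the code. Where \<open>b\<close>
  is constant there is no descent, so an excedance at \<open>i\<close> forces one at
  \<open>Suc i\<close>; the code then does not decrease, and \<open>\<sigma>\<close> breaks ties the
  right way.\<close>

lemma exc_code_mono:
  assumes \<sigma>: "\<sigma> permutes {1..n}" and b: "b \<in> compat n M (DES n \<sigma>)"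
    and "i \<in> {1..n}" "k \<in> {1..n}" "i < k"
  shows "(exc_code M \<sigma> b i, \<sigma> i) < (exc_code M \<sigma> b k, \<sigma> k)"
proof (rule strict_chain[of n])
  fix i assume i: "i \<in> {1..<n}"
  have le: "b (Suc i) \<le> b i" "b i \<le> M"
    using compat_antimono[OF b, of i "Suc i"] compat_le[OF b, of i] by auto
  have "\<sigma> i < \<sigma> (Suc i)" if "b (Suc i) = b i"
  proof -
    have "i \<notin> DES n \<sigma>" using that b by (auto simp: compat_def)
    moreover have "\<sigma> i \<noteq> \<sigma> (Suc i)" using permutes_inj[OF \<sigma>] by (metis injD n_not_Suc_n)
    ultimately show ?thesis using i by (auto simp: DES_def)
  qed
  then show "(exc_code M \<sigma> b i, \<sigma> i) < (exc_code M \<sigma> b (Suc i), \<sigma> (Suc i))"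
    using le by (cases "b (Suc i) = b i") (auto simp: exc_code_def)
qed (use assms in auto)

text \<open>Exceeding the bound would take an excedance with \<open>b i = 0\<close>. From
  \<open>i\<close> on \<open>b\<close> vanishes, so \<open>\<sigma>\<close> has no further descents
  and rises by at least 1 per step up to \<open>\<sigma> n \<le> n\<close>, which leaves
  \<open>\<sigma> i \<le> i\<close>.\<close>

lemma exc_code_le:
  assumes \<sigma>: "\<sigma> permutes {1..n}" and b: "b \<in> compat n M (DES n \<sigma>)" and i: "i \<in> {1..n}"
  shows "exc_code M \<sigma> b i \<le> 2 * M"
proof (cases "b i = 0")
  case True
  have "\<sigma> (i + d) \<ge> \<sigma> i + d" if "i + d \<le> n" for d
    using that
  proof (induction d)
    case (Suc d)
    have "b (i + d) = 0" "b (Suc (i + d)) = 0"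
      using compat_antimono[OF b, of i "i + d"] compat_antimono[OF b, of i "Suc (i + d)"] True by auto
    then have "i + d \<notin> DES n \<sigma>" using b by (auto simp: compat_def)
    moreover have "\<sigma> (i + d) \<noteq> \<sigma> (Suc (i + d))" using permutes_inj[OF \<sigma>] by (metis injD n_not_Suc_n)
    ultimately show ?case using Suc i by (auto simp: DES_def)
  qed simp
  from this[of "n - i"] have "\<sigma> i + (n - i) \<le> \<sigma> n" using i by simp
  moreover have "\<sigma> n \<in> {1..n}" using permutes_in_image[OF \<sigma>, of n] i by auto
  ultimately have "\<not> i < \<sigma> i" using i by auto
  then show ?thesis by (simp add: exc_code_def)
next
  case False
  then show ?thesis using compat_le[OF b, of i] by (auto simp: exc_code_def)
qed

lemma nth_exc_word:
  assumes "\<sigma> permutes {1..n}" "i \<in> {1..n}"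
  shows "exc_word n M \<sigma> b ! (\<sigma> i - 1) = exc_code M \<sigma> b i"
  using permutes_in_image[OF assms(1), of i] assms(2) permutes_inverses(2)[OF assms(1), of i]
  unfolding exc_word_def by (subst nth_map_upt1) auto

lemma rank_exc_word:
  assumes "\<sigma> permutes {1..n}" "b \<in> compat n M (DES n \<sigma>)"
  shows "rank n (letter_key (exc_word n M \<sigma> b)) = inv \<sigma>"
  using exc_code_mono[OF assms]
  by (intro sorted_by_key[OF assms(1) _ inj_letter_key])
     (simp only: letter_key_def nth_exc_word[OF assms(1)])

lemma exc_word_mem:
  assumes "\<sigma> permutes {1..n}" "b \<in> compat n M (DES n \<sigma>)"
  shows "exc_word n M \<sigma> b \<in> rearrangements n (Suc (2 * M))"
  unfolding rearrangements_iff_rank rank_exc_word[OF assms]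
proof (intro conjI ballI)
  show "length (exc_word n M \<sigma> b) = n" by (simp add: exc_word_def)
  have inv: "inv \<sigma> j \<in> {1..n}" if "j \<in> {1..n}" for j
    using permutes_in_image[OF permutes_inv[OF assms(1)]] that by blast
  show "set (exc_word n M \<sigma> b) \<subseteq> {..<Suc (2 * M)}"
    using exc_code_le[OF assms inv] by (auto simp: exc_word_def less_Suc_eq_le simp del: upt_Suc)
  show "odd (exc_word n M \<sigma> b ! (j - 1)) \<longleftrightarrow> inv \<sigma> j < j" if "j \<in> {1..n}" for j
    using that unfolding exc_word_def
    by (subst nth_map_upt1) (auto simp: exc_code_def permutes_inverses(1)[OF assms(1)])
qed

lemma rank_inverse_key_mono:
  assumes "inj_on key {1..n}" "i \<in> {1..n}" "k \<in> {1..n}" "i < k"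
  defines "\<sigma> \<equiv> inv (rank n key)"
  shows "key (\<sigma> i) < key (\<sigma> k)"
proof -
  have p: "rank n key permutes {1..n}" using rank_permutes[OF assms(1)] .
  have "\<sigma> i \<in> {1..n}" "\<sigma> k \<in> {1..n}"
    using permutes_in_image[OF permutes_inv[OF p]] assms by blast+
  from rank_less_iff[OF assms(1) this] show ?thesis
    using assms(4) permutes_inverses(1)[OF p] by (simp add: \<sigma>_def)
qed

lemma exc_word_surj:
  assumes v: "v \<in> rearrangements n (Suc (2 * M))"
  shows "\<exists>\<sigma> b. \<sigma> permutes {1..n} \<and> b \<in> compat n M (DES n \<sigma>) \<and> exc_word n M \<sigma> b = v"
proof -
  let ?\<tau> = "rank n (letter_key v)"
  define \<sigma> where "\<sigma> = inv ?\<tau>"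
  have len: "length v = n" and sub: "set v \<subseteq> {..<Suc (2 * M)}"
    and par: "\<And>j. j \<in> {1..n} \<Longrightarrow> odd (v ! (j - 1)) \<longleftrightarrow> ?\<tau> j < j"
    using v unfolding rearrangements_iff_rank by auto
  have \<tau>: "?\<tau> permutes {1..n}" using rank_permutes[OF inj_letter_key] .
  then have \<sigma>: "\<sigma> permutes {1..n}" unfolding \<sigma>_def by (rule permutes_inv)
  have in\<sigma>: "\<sigma> i \<in> {1..n}" if "i \<in> {1..n}" for i using permutes_in_image[OF \<sigma>] that by blast
  have \<tau>\<sigma>: "?\<tau> (\<sigma> i) = i" for i unfolding \<sigma>_def by (rule permutes_inverses(1)[OF \<tau>])
  have inv\<sigma>: "inv \<sigma> = ?\<tau>" unfolding \<sigma>_def by (rule permutes_inv_inv[OF \<tau>])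
  define c where "c i = v ! (\<sigma> i - 1)" for i
  define b where "b i = (if i = 0 then M else if i \<le> n then M - c i div 2 else 0)" for i
  have c_le: "c i \<le> 2 * M" if "i \<in> {1..n}" for i
  proof -
    have "\<sigma> i - 1 < length v" using in\<sigma>[OF that] len by auto
    then show ?thesis using sub nth_mem unfolding c_def by fastforce
  qed
  have c_par: "odd (c i) \<longleftrightarrow> i < \<sigma> i" if "i \<in> {1..n}" for i
    unfolding c_def using par[OF in\<sigma>[OF that]] \<tau>\<sigma> by simp
  have key: "(c i, \<sigma> i) < (c k, \<sigma> k)" if "i \<in> {1..n}" "k \<in> {1..n}" "i < k" for i k
    using rank_inverse_key_mono[OF inj_letter_key that, of v] unfolding c_def \<sigma>_def letter_key_def .
  have code: "exc_code M \<sigma> b i = c i" if "i \<in> {1..n}" for i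
    using c_le[OF that] c_par[OF that] that unfolding exc_code_def b_def
    by (cases "odd (c i)") (auto elim!: oddE evenE)
  have "b (Suc i) \<le> b i" if "i < n" for i
  proof (cases "i = 0")
    case False
    then have "c i \<le> c (Suc i)" using key[of i "Suc i"] that by auto
    with False that show ?thesis by (auto simp: b_def intro!: diff_le_mono2 div_le_mono)
  qed (simp add: b_def)
  moreover have "b (Suc i) < b i" if "i \<in> DES n \<sigma>" for i
  proof -
    from that have i: "i \<in> {1..n}" "Suc i \<in> {1..n}" "\<sigma> (Suc i) < \<sigma> i" by (auto simp: DES_def)
    then have lt: "c i < c (Suc i)" using key[of i "Suc i"] by auto
    \<comment> \<open>With equal halves \<open>c i\<close> would be even and
      \<open>c (Suc i)\<close> odd, that is \<open>\<sigma> i \<le> i\<close> and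
      \<open>Suc i < \<sigma> (Suc i)\<close>, against the descent at \<open>i\<close>.\<close>
    have "c i div 2 < c (Suc i) div 2"
    proof (rule ccontr)
      assume "\<not> c i div 2 < c (Suc i) div 2"
      with lt have "even (c i)" "odd (c (Suc i))" by presburger+
      with c_par[OF i(1)] c_par[OF i(2)] i show False by simp
    qed
    moreover have "c (Suc i) div 2 \<le> M" using c_le[OF i(2)] by simp
    ultimately show ?thesis using i by (simp add: b_def)
  qed
  ultimately have "b \<in> compat n M (DES n \<sigma>)" by (auto simp: compat_def b_def)
  moreover have "exc_word n M \<sigma> b = v"
  proof (rule nth_equalityI)
    show "length (exc_word n M \<sigma> b) = length v" by (simp add: exc_word_def len)
    fix j assume "j < length (exc_word n M \<sigma> b)"
    then have j: "Suc j \<in> {1..n}" by (auto simp: exc_word_def simp del: upt_Suc)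
    have "?\<tau> (Suc j) \<in> {1..n}" using permutes_in_image[OF \<tau>] j by blast
    from code[OF this] nth_map_upt1[OF j, of "\<lambda>j. exc_code M \<sigma> b (inv \<sigma> j)"]
    show "exc_word n M \<sigma> b ! j = v ! j"
      unfolding exc_word_def inv\<sigma> c_def using permutes_inverses(2)[OF \<tau>]
      by (simp add: \<sigma>_def del: upt_Suc)
  qed
  ultimately show ?thesis using \<sigma> by blast
qed

lemma exc_word_inj:
  assumes "\<sigma> permutes {1..n}" "b \<in> compat n M (DES n \<sigma>)"
    and "\<sigma>' permutes {1..n}" "b' \<in> compat n M (DES n \<sigma>')"
    and eq: "exc_word n M \<sigma> b = exc_word n M \<sigma>' b'"
  shows "\<sigma> = \<sigma>' \<and> b = b'"
proof -
  have "inv \<sigma> = inv \<sigma>'" using rank_exc_word[OF assms(1,2)] rank_exc_word[OF assms(3,4)] eq by simp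
  then have \<sigma>: "\<sigma> = \<sigma>'" using permutes_inv_inv assms(1,3) by metis
  have "exc_code M \<sigma> b i = exc_code M \<sigma>' b' i" if "i \<in> {1..n}" for i
    using nth_exc_word[OF assms(1) that, of M b] nth_exc_word[OF assms(3) that, of M b'] eq \<sigma> by simp
  then have "M - b i = M - b' i" if "i \<in> {1..n}" for i
    using that unfolding exc_code_def \<sigma> by simp
  from compat_eqI[OF assms(2,4) this] \<sigma> show ?thesis by simp
qed

lemma bij_betw_exc_word:
  "bij_betw (\<lambda>(\<sigma>, b). exc_word n M \<sigma> b) (SIGMA \<sigma>:sym_perms n. compat n M (DES n \<sigma>))
     (rearrangements n (Suc (2 * M)))"
  unfolding bij_betw_def
proof
  show "inj_on (\<lambda>(\<sigma>, b). exc_word n M \<sigma> b) (SIGMA \<sigma>:sym_perms n. compat n M (DES n \<sigma>))"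
    using exc_word_inj by (auto simp: inj_on_def sym_perms_def)
  show "(\<lambda>(\<sigma>, b). exc_word n M \<sigma> b) ` (SIGMA \<sigma>:sym_perms n. compat n M (DES n \<sigma>))
      = rearrangements n (Suc (2 * M))"
  proof (intro equalityI subsetI)
    fix v assume "v \<in> rearrangements n (Suc (2 * M))"
    from exc_word_surj[OF this] show "v \<in> (\<lambda>(\<sigma>, b). exc_word n M \<sigma> b) ` (SIGMA \<sigma>:sym_perms n. compat n M (DES n \<sigma>))"
      by (auto simp: sym_perms_def image_def)
  qed (auto simp: sym_perms_def exc_word_mem)
qed

section \<open>Descents of the inverse\<close>

text \<open>With \<open>b 0 = M\<close>, a gap at position \<open>0\<close> is the extra ascent counted by \<open>asc2_tilde\<close>.\<close>

definition gaps :: "nat \<Rightarrow> (nat \<Rightarrow> nat) \<Rightarrow> nat set" where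
  "gaps n \<sigma> = (if \<sigma> 1 = 1 then ASC2 n \<sigma> else insert 0 (ASC2 n \<sigma>))"

definition level :: "nat list \<Rightarrow> nat \<Rightarrow> nat" where
  "level w j = Suc (w ! (j - 1)) div 2"

definition breaks :: "nat list \<Rightarrow> nat \<Rightarrow> nat set" where
  "breaks w j = {i \<in> {2..j}. odd (w ! (i - 1)) \<or> level w (i - 1) \<noteq> level w i}"

text \<open>
  Within a level, a permutation without gaps lists maximal runs of consecutive values in decreasing
  order of the runs, so it is recovered by sorting the values by this key.
\<close>

definition run_key :: "nat list \<Rightarrow> nat \<Rightarrow> nat \<times> int \<times> nat" where
  "run_key w j = (level w j, - int (card (breaks w j)), j)"

text \<open>On level 0 the truncated subtraction would swallow a mark;
  \<open>descent_below_top\<close> shows that no mark occurs there.\<close>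

definition ides_word :: "nat \<Rightarrow> nat \<Rightarrow> (nat \<Rightarrow> nat) \<Rightarrow> (nat \<Rightarrow> nat) \<Rightarrow> nat list" where
  "ides_word n M \<tau> b = map (\<lambda>j. 2 * (M - b (\<tau> j)) - of_bool (2 \<le> j \<and> \<tau> j < \<tau> (j - 1))) [1..<Suc n]"

lemma inj_run_key: "inj_on (run_key w) A"
  by (auto simp: run_key_def inj_on_def)

lemma walk_iff_nth: "walk u w \<longleftrightarrow> (\<forall>i < length w. step ((u # w) ! i) (w ! i))"
proof (induction w arbitrary: u)
  case (Cons a w)
  show ?case unfolding walk.simps Cons.IH by (auto simp: nth_Cons split: nat.splits)
qed simp

lemma breaks_mono: "j \<le> k \<Longrightarrow> breaks w j \<subseteq> breaks w k"
  by (auto simp: breaks_def)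

lemma finite_breaks: "finite (breaks w j)"
  by (simp add: breaks_def)

lemma breaks_Suc:
  assumes "1 \<le> j"
  shows "card (breaks w (Suc j)) = card (breaks w j) + of_bool (odd (w ! j) \<or> level w j \<noteq> level w (Suc j))"
proof -
  have "breaks w (Suc j) = (if odd (w ! j) \<or> level w j \<noteq> level w (Suc j)
      then insert (Suc j) (breaks w j) else breaks w j)"
    using assms by (auto simp: breaks_def le_Suc_eq)
  moreover have "Suc j \<notin> breaks w j" by (simp add: breaks_def)
  ultimately show ?thesis using finite_breaks[of w j] by simp
qed

lemma not_break:
  assumes "card (breaks w j) = card (breaks w k)" "j < i" "i \<le> k" "1 \<le> j"
  shows "even (w ! (i - 1)) \<and> level w (i - 1) = level w i"
proof -
  have "breaks w j = breaks w k"
    using breaks_mono[of j k w] finite_breaks[of w k] assms by (intro card_subset_eq) auto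
  moreover have "i \<notin> breaks w j" using assms by (auto simp: breaks_def)
  ultimately have "i \<notin> breaks w k" by simp
  then show ?thesis using assms by (auto simp: breaks_def)
qed

text \<open>After a gap-free drop the sequence can only return to a larger value by passing through the
  value it left, which is already taken.\<close>

lemma gap_free_climb:
  fixes \<sigma> :: "nat \<Rightarrow> nat"
  assumes "inj \<sigma>" "p \<le> p'" "\<And>i. p \<le> i \<Longrightarrow> i < p' \<Longrightarrow> \<sigma> (Suc i) \<le> Suc (\<sigma> i)" "\<sigma> p \<le> \<sigma> p'"
    and "d \<le> \<sigma> p' - \<sigma> p"
  shows "\<sigma> (p + d) = \<sigma> p + d"
  using assms(2-)
proof (induction "p' - p" arbitrary: p d)
  case (Suc m)
  have lt: "p < p'" using Suc.hyps(2) by simp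
  then have "\<sigma> p \<noteq> \<sigma> p'" using assms(1) by (metis injD less_irrefl)
  then have less: "\<sigma> p < \<sigma> p'" using Suc.prems by simp
  have ne: "\<sigma> (Suc p) \<noteq> \<sigma> p" using assms(1) by (metis injD n_not_Suc_n)
  have step: "\<sigma> (Suc p) \<le> Suc (\<sigma> p)" using Suc.prems lt by simp
  then have le: "\<sigma> (Suc p) \<le> \<sigma> p'" using less by simp
  have IH: "\<sigma> (Suc p + e) = \<sigma> (Suc p) + e" if "e \<le> \<sigma> p' - \<sigma> (Suc p)" for e
    using Suc.hyps(1)[of "Suc p" e] Suc.hyps(2) Suc.prems(2) lt le that by simp
  have "\<sigma> (Suc p) = Suc (\<sigma> p)"
  proof (rule ccontr)
    assume "\<sigma> (Suc p) \<noteq> Suc (\<sigma> p)"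
    with step ne have "\<sigma> (Suc p) < \<sigma> p" by simp
    with IH[of "\<sigma> p - \<sigma> (Suc p)"] less have "\<sigma> (Suc p + (\<sigma> p - \<sigma> (Suc p))) = \<sigma> p" by simp
    from injD[OF assms(1) this] show False by simp
  qed
  with IH[of "d - 1"] Suc.prems(4) show ?case by (cases d) auto
qed simp

section \<open>Permutations with compatible sequences as walks\<close>

context
  fixes n M :: nat and \<sigma> b \<tau> :: "nat \<Rightarrow> nat"
  assumes \<sigma>: "\<sigma> permutes {1..n}" and b: "b \<in> compat n M (gaps n \<sigma>)"
  defines "\<tau> \<equiv> inv \<sigma>"
begin

lemma inverse_permutes: "\<tau> permutes {1..n}"
  unfolding \<tau>_def using \<sigma> by (rule permutes_inv)

lemma inverse_in: "j \<in> {1..n} \<Longrightarrow> \<tau> j \<in> {1..n}"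
  using permutes_in_image[OF inverse_permutes] by blast

lemma perm_inverse: "\<sigma> (\<tau> j) = j" and inverse_perm: "\<tau> (\<sigma> j) = j"
  unfolding \<tau>_def using permutes_inverses[OF \<sigma>] by auto

lemma b_less_imp: "b (\<tau> k) < b (\<tau> j) \<Longrightarrow> \<tau> j < \<tau> k"
  using compat_antimono[OF b, of "\<tau> k" "\<tau> j"] by (cases "\<tau> j < \<tau> k") auto

lemma no_gap:
  assumes "i \<in> {1..<n}" "b (Suc i) = b i"
  shows "\<sigma> (Suc i) \<le> Suc (\<sigma> i)"
proof -
  have "i \<notin> gaps n \<sigma>" using assms(2) b by (auto simp: compat_def)
  then have "i \<notin> ASC2 n \<sigma>" by (simp add: gaps_def split: if_splits)
  then show ?thesis using assms(1) by (auto simp: ASC2_def)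
qed

text \<open>While \<open>b\<close> stays at \<open>M\<close> no gap is allowed, not even at 0. So
  \<open>\<sigma>\<close> starts with 1 and rises by at most 1 per step; the smaller values being
  used up, it is the identity there.\<close>

lemma top_level_fixed:
  assumes "b i = M" "i \<in> {1..n}"
  shows "\<sigma> i = i"
  using assms
proof (induction i rule: less_induct)
  case (less i)
  have bM: "b k = M" if "k \<le> i" for k
    using compat_antimono[OF b that] compat_le[OF b, of k] less.prems(1) by simp
  show ?case
  proof (cases "i = 1")
    case True
    have "0 \<notin> gaps n \<sigma>" using bM[of 1] bM[of 0] True b by (auto simp: compat_def)
    with True show ?thesis by (simp add: gaps_def split: if_splits)
  next
    case False
    then obtain k where k: "i = Suc k" "1 \<le> k" using less.prems by (cases i) auto
    have below: "\<sigma> l = l" if "l < i" for l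
      using less.IH[OF that] bM[of l] that less.prems(2) permutes_not_in[OF \<sigma>, of 0] by (cases "l = 0") auto
    have "\<sigma> i \<le> i" using no_gap[of k] k less.prems(2) bM[of k] bM[of i] below[of k] by simp
    moreover have "\<not> \<sigma> i < i"
    proof
      assume lt: "\<sigma> i < i"
      from below[OF lt] have "\<sigma> i = i" by (rule injD[OF permutes_inj[OF \<sigma>]])
      with lt show False by simp
    qed
    ultimately show ?thesis by simp
  qed
qed

lemma descent_below_top:
  assumes "j \<in> {2..n}" "\<tau> j < \<tau> (j - 1)"
  shows "b (\<tau> j) < M"
proof (rule ccontr)
  assume "\<not> b (\<tau> j) < M"
  then have "b (\<tau> j) = M" using compat_le[OF b, of "\<tau> j"] by simp
  with inverse_in[of j] assms top_level_fixed have j: "\<tau> j = j" using perm_inverse by fastforce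
  have "b (j - 1) = M"
    using compat_antimono[OF b, of "j - 1" j] compat_le[OF b, of "j - 1"] \<open>b (\<tau> j) = M\<close> j by simp
  moreover have "j - 1 \<in> {1..n}" using assms(1) by auto
  ultimately have "\<sigma> (j - 1) = j - 1" by (rule top_level_fixed)
  with inverse_perm have "\<tau> (j - 1) = j - 1" by metis
  with assms j show False by simp
qed

lemma nth_ides_word:
  assumes "j \<in> {1..n}"
  shows "ides_word n M \<tau> b ! (j - 1) = 2 * (M - b (\<tau> j)) - of_bool (2 \<le> j \<and> \<tau> j < \<tau> (j - 1))"
  unfolding ides_word_def using assms by (rule nth_map_upt1)

lemma odd_ides_word:
  assumes "j \<in> {1..n}"
  shows "odd (ides_word n M \<tau> b ! (j - 1)) \<longleftrightarrow> 2 \<le> j \<and> \<tau> j < \<tau> (j - 1)"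
proof (cases "2 \<le> j \<and> \<tau> j < \<tau> (j - 1)")
  case True
  then have "b (\<tau> j) < M" using descent_below_top[of j] assms by auto
  then obtain x where x: "M - b (\<tau> j) = Suc x" by (cases "M - b (\<tau> j)") auto
  then show ?thesis unfolding nth_ides_word[OF assms] x using True by simp
next
  case False
  then have "of_bool (2 \<le> j \<and> \<tau> j < \<tau> (j - 1)) = (0::nat)" by simp
  with False show ?thesis unfolding nth_ides_word[OF assms] by (simp only: diff_zero) simp
qed

lemma level_ides_word:
  assumes "j \<in> {1..n}"
  shows "level (ides_word n M \<tau> b) j = M - b (\<tau> j)"
proof (cases "2 \<le> j \<and> \<tau> j < \<tau> (j - 1)")
  case True
  then have "b (\<tau> j) < M" using descent_below_top[of j] assms by auto
  then show ?thesis unfolding level_def nth_ides_word[OF assms] using True by auto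
next
  case False
  then have "of_bool (2 \<le> j \<and> \<tau> j < \<tau> (j - 1)) = (0::nat)" by simp
  then show ?thesis unfolding level_def nth_ides_word[OF assms] by (simp only: diff_zero)
qed

lemma run_key_ides_word:
  assumes j: "j \<in> {1..n}" and k: "k \<in> {1..n}"
    and less: "run_key (ides_word n M \<tau> b) j < run_key (ides_word n M \<tau> b) k"
  shows "\<tau> j < \<tau> k"
proof -
  let ?w = "ides_word n M \<tau> b"
  let ?r = "\<lambda>j. card (breaks ?w j)"
  consider "level ?w j < level ?w k" | "level ?w j = level ?w k" "?r k < ?r j"
    | "level ?w j = level ?w k" "?r j = ?r k" "j < k"
    using less by (auto simp: run_key_def le_less)
  then show ?thesis
  proof cases
    case 1
    then have "b (\<tau> k) < b (\<tau> j)" using level_ides_word[OF j] level_ides_word[OF k] by linarith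
    then show ?thesis by (rule b_less_imp)
  next
    case 2
    have "k < j" using 2(2) card_mono[OF finite_breaks breaks_mono, of j k ?w] by (cases "k < j") auto
    have same: "b (\<tau> j) = b (\<tau> k)"
      using 2(1) level_ides_word[OF j] level_ides_word[OF k]
        compat_le[OF b, of "\<tau> j"] compat_le[OF b, of "\<tau> k"] by linarith
    show ?thesis
    proof (rule ccontr)
      \<comment> \<open>If \<open>k\<close> stood before \<open>j\<close>, all positions between
        them would have one level and hence no gaps. The climb from \<open>k\<close> to
        \<open>j\<close> would then take every intermediate value in turn, and such a run contains
        no break.\<close>
      assume "\<not> \<tau> j < \<tau> k"
      then have le: "\<tau> k \<le> \<tau> j" by simp
      have const: "b i = b (\<tau> k)" if "\<tau> k \<le> i" "i \<le> \<tau> j" for i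
        using compat_antimono[OF b that(1)] compat_antimono[OF b that(2)] same by simp
      have "\<sigma> (Suc i) \<le> Suc (\<sigma> i)" if "\<tau> k \<le> i" "i < \<tau> j" for i
        using no_gap[of i] const[of i] const[of "Suc i"] that inverse_in[OF j] inverse_in[OF k] by auto
      from gap_free_climb[OF permutes_inj[OF \<sigma>] le this]
      have climb: "\<sigma> (\<tau> k + d) = k + d" if "d \<le> j - k" for d
        using that \<open>k < j\<close> by (simp add: perm_inverse)
      have \<tau>_climb: "\<tau> (k + d) = \<tau> k + d" if "d \<le> j - k" for d
        using climb[OF that] inverse_perm by metis
      have "breaks ?w j \<subseteq> breaks ?w k"
      proof
        fix i assume i: "i \<in> breaks ?w j"
        show "i \<in> breaks ?w k"
        proof (rule ccontr)
          assume "i \<notin> breaks ?w k"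
          with i have "k < i" "i \<le> j" by (auto simp: breaks_def)
          have "\<tau> i = \<tau> k + (i - k)" "\<tau> (i - 1) = \<tau> k + (i - 1 - k)"
            using \<tau>_climb[of "i - k"] \<tau>_climb[of "i - 1 - k"] \<open>k < i\<close> \<open>i \<le> j\<close> by simp_all
          moreover have "\<tau> j = \<tau> k + (j - k)" using \<tau>_climb[of "j - k"] \<open>k < j\<close> by simp
          ultimately have "\<tau> (i - 1) < \<tau> i" "b (\<tau> i) = b (\<tau> k)" "b (\<tau> (i - 1)) = b (\<tau> k)"
            using \<open>k < i\<close> \<open>i \<le> j\<close> by (auto intro!: const)
          moreover have "i \<in> {1..n}" "i - 1 \<in> {1..n}" using \<open>k < i\<close> \<open>i \<le> j\<close> j k by auto
          ultimately show False
            using i odd_ides_word[of i] level_ides_word[of i] level_ides_word[of "i - 1"]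
            by (auto simp: breaks_def)
        qed
      qed
      then show False using 2(2) card_mono[OF finite_breaks, of "breaks ?w j" ?w k] by simp
    qed
  next
    case 3
    have "\<tau> j < \<tau> i" if "j < i" "i \<le> k" for i
      using that
    proof (induction i)
      case (Suc i)
      have "even (?w ! i)" "level ?w i = level ?w (Suc i)"
        using not_break[OF 3(2), of "Suc i"] Suc.prems j by auto
      moreover have "Suc i \<in> {1..n}" "1 \<le> i" using Suc.prems j k by auto
      ultimately have "\<not> \<tau> (Suc i) < \<tau> i" using odd_ides_word[of "Suc i"] by auto
      moreover have "\<tau> (Suc i) \<noteq> \<tau> i" using permutes_inj[OF inverse_permutes] by (metis injD n_not_Suc_n)
      ultimately have "\<tau> i < \<tau> (Suc i)" by simp
      then show ?case using Suc by (cases "j = i") (auto intro: less_trans)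
    qed simp
    then show ?thesis using 3(3) by simp
  qed
qed

lemma rank_ides_word: "rank n (run_key (ides_word n M \<tau> b)) = \<tau>"
  by (rule rank_unique[OF inverse_permutes inj_run_key run_key_ides_word])

lemma ides_word_mem: "ides_word n M \<tau> b \<in> {w \<in> walks (Suc (2 * M)). length w = n}"
proof -
  let ?w = "ides_word n M \<tau> b"
  have len: "length ?w = n" by (simp add: ides_word_def)
  have "set ?w \<subseteq> {..<Suc (2 * M)}" by (auto simp: ides_word_def simp del: upt_Suc)
  moreover have "step ((0 # ?w) ! i) (?w ! i)" if "i < n" for i
  proof (cases i)
    case 0
    then show ?thesis using odd_ides_word[of 1] that by (auto simp: step_def)
  next
    case (Suc k)
    let ?l = "\<lambda>j. M - b (\<tau> j)"
    have ki: "i \<in> {1..n}" "Suc i \<in> {1..n}" "k = i - 1" using Suc that by auto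
    have w: "?w ! k = 2 * ?l i - of_bool (2 \<le> i \<and> \<tau> i < \<tau> (i - 1))"
      "?w ! i = 2 * ?l (Suc i) - of_bool (\<tau> (Suc i) < \<tau> i)"
      using nth_ides_word[OF ki(1)] nth_ides_word[OF ki(2)] ki by simp_all
    show ?thesis
    proof (cases "\<tau> (Suc i) < \<tau> i")
      case True
      then have "?l (Suc i) \<le> ?l i" using compat_antimono[OF b, of "\<tau> (Suc i)" "\<tau> i"] by simp
      \<comment> \<open>The flag \<open>P\<close> is arbitrary because the preceding letter may
        itself be marked.\<close>
      moreover have "2 * x - 1 \<le> 2 * y - (of_bool P :: nat)" if "x \<le> y" for x y P
        using that by (cases P) auto
      ultimately have "?w ! i \<le> ?w ! k" unfolding w using True by simp
      moreover have "odd (?w ! i)" using odd_ides_word[OF ki(2)] True ki by simp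
      ultimately show ?thesis using Suc by (simp add: step_def)
    next
      case False
      then have "?l i \<le> ?l (Suc i)" using compat_antimono[OF b, of "\<tau> i" "\<tau> (Suc i)"] by simp
      then have "?w ! k \<le> ?w ! i" unfolding w using False by simp
      moreover have "even (?w ! i)" using odd_ides_word[OF ki(2)] False ki by simp
      ultimately show ?thesis using Suc by (simp add: step_def)
    qed
  qed
  ultimately show ?thesis using len unfolding walks_def walk_iff_nth by simp
qed

end

section \<open>Recovering the permutation and its sequence from a walk\<close>

lemma walk_to_0:
  assumes "walk 0 w" "i < length w" "w ! i = 0" "k \<le> i"
  shows "w ! k = 0"
  using assms(4)
proof (induction k rule: inc_induct)
  case (step k)
  then have "Suc k < length w" using assms(2) by simp
  with assms(1) have "step ((0 # w) ! Suc k) (w ! Suc k)" unfolding walk_iff_nth by blast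
  with step.IH show ?case by (simp add: step_def)
qed (rule assms(3))

lemma ides_word_surj:
  assumes w: "w \<in> walks (Suc (2 * M))" "length w = n"
  shows "\<exists>\<sigma> b. \<sigma> permutes {1..n} \<and> b \<in> compat n M (gaps n \<sigma>) \<and> ides_word n M (inv \<sigma>) b = w"
proof -
  define \<tau> where "\<tau> = rank n (run_key w)"
  define \<sigma> where "\<sigma> = inv \<tau>"
  let ?r = "\<lambda>j. card (breaks w j)"
  have sub: "set w \<subseteq> {..2 * M}" and walk: "walk 0 w" using w by (auto simp: walks_def less_Suc_eq_le)
  have \<tau>: "\<tau> permutes {1..n}" unfolding \<tau>_def using rank_permutes[OF inj_run_key] .
  then have \<sigma>: "\<sigma> permutes {1..n}" unfolding \<sigma>_def by (rule permutes_inv)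
  have in\<sigma>: "\<sigma> i \<in> {1..n}" if "i \<in> {1..n}" for i using permutes_in_image[OF \<sigma>] that by blast
  have \<tau>\<sigma>: "\<tau> (\<sigma> i) = i" and \<sigma>\<tau>: "\<sigma> (\<tau> i) = i" for i
    unfolding \<sigma>_def using permutes_inverses[OF \<tau>] by auto
  have inv\<sigma>: "inv \<sigma> = \<tau>" unfolding \<sigma>_def by (rule permutes_inv_inv[OF \<tau>])
  have iff: "\<tau> j < \<tau> k \<longleftrightarrow> run_key w j < run_key w k" if "j \<in> {1..n}" "k \<in> {1..n}" for j k
    unfolding \<tau>_def using rank_less_iff[OF inj_run_key that] .
  define b where "b i = (if i = 0 then M else if i \<le> n then M - level w (\<sigma> i) else 0)" for i
  have w_le: "w ! (j - 1) \<le> 2 * M" if "j \<in> {1..n}" for j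
  proof -
    have "j - 1 < length w" using that w(2) by auto
    then show ?thesis using sub nth_mem by blast
  qed
  have level_le: "level w j \<le> M" if "j \<in> {1..n}" for j
    using w_le[OF that] unfolding level_def by simp
  have key: "run_key w (\<sigma> i) < run_key w (\<sigma> k)" if "i \<in> {1..n}" "k \<in> {1..n}" "i < k" for i k
    using iff[OF in\<sigma>[OF that(1)] in\<sigma>[OF that(2)]] that(3) by (simp add: \<tau>\<sigma>)
  have step: "if odd (w ! (j - 1)) then w ! (j - 1) \<le> w ! (j - 2) else w ! (j - 2) \<le> w ! (j - 1)"
    if "j \<in> {2..n}" for j
  proof -
    define i where "i = j - 2"
    have i: "j = Suc (Suc i)" using that by (auto simp: i_def)
    then have "Suc i < length w" using w(2) that by simp
    with walk have "step ((0 # w) ! Suc i) (w ! Suc i)" unfolding walk_iff_nth by blast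
    then show ?thesis by (simp add: i step_def split: if_splits)
  qed
  have par: "odd (w ! (j - 1)) \<longleftrightarrow> 2 \<le> j \<and> \<tau> j < \<tau> (j - 1)" if "j \<in> {1..n}" for j
  proof (cases "j = 1")
    case True
    then have "0 < length w" using w(2) that by auto
    with walk have "step ((0 # w) ! 0) (w ! 0)" unfolding walk_iff_nth by blast
    then show ?thesis using True by (auto simp: step_def split: if_splits)
  next
    case False
    then have j: "j \<in> {2..n}" "j - 1 \<in> {1..n}" "2 \<le> j" "1 \<le> j - 1" using that by auto
    have br: "?r j = ?r (j - 1) + of_bool (odd (w ! (j - 1)) \<or> level w (j - 1) \<noteq> level w j)"
      using breaks_Suc[OF j(4), of w] j(3) by (simp add: numeral_2_eq_2)
    have lev: "level w (j - 1) = Suc (w ! (j - 2)) div 2" "level w j = Suc (w ! (j - 1)) div 2"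
      by (simp_all add: level_def numeral_2_eq_2)
    show ?thesis
    proof (cases "odd (w ! (j - 1))")
      case True
      then have "level w j \<le> level w (j - 1)" using step[OF j(1)] True unfolding lev by (intro div_le_mono) simp
      then have "run_key w j < run_key w (j - 1)" using br True by (auto simp: run_key_def)
      then show ?thesis using iff[OF that j(2)] True j(3) by simp
    next
      case False
      then have "level w (j - 1) \<le> level w j" using step[OF j(1)] False unfolding lev by (intro div_le_mono) simp
      then have "run_key w (j - 1) < run_key w j" using br False j(3) by (auto simp: run_key_def)
      then have "\<tau> (j - 1) < \<tau> j" using iff[OF j(2) that] by simp
      then show ?thesis using False by simp
    qed
  qed
  have code: "w ! (j - 1) = 2 * level w j - of_bool (odd (w ! (j - 1)))" for j
    unfolding level_def by (cases "odd (w ! (j - 1))") (auto elim!: oddE evenE)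
  have "b (Suc i) \<le> b i" if "i < n" for i
  proof (cases "i = 0")
    case False
    then have "level w (\<sigma> i) \<le> level w (\<sigma> (Suc i))"
      using key[of i "Suc i"] that by (auto simp: run_key_def)
    with False that show ?thesis by (auto simp: b_def)
  qed (simp add: b_def)
  moreover have "b (Suc i) < b i" if "i \<in> ASC2 n \<sigma>" for i
  proof -
    let ?j = "\<sigma> i" and ?k = "\<sigma> (Suc i)"
    from that have i: "i \<in> {1..n}" "Suc i \<in> {1..n}" "Suc ?j < ?k" by (auto simp: ASC2_def)
    note lt = key[OF i(1,2)]
    \<comment> \<open>On a common level the keys force \<open>?j\<close> and \<open>?k\<close> into
      the same run. Then \<open>Suc ?j\<close> is sorted strictly between them, although their
      positions \<open>i\<close> and \<open>Suc i\<close> are adjacent.\<close>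
    have "level w ?j < level w ?k"
    proof (rule ccontr)
      assume "\<not> level w ?j < level w ?k"
      with lt have "level w ?j = level w ?k" "?r ?k \<le> ?r ?j" by (auto simp: run_key_def)
      moreover have "?r ?j \<le> ?r (Suc ?j)" "?r (Suc ?j) \<le> ?r ?k"
        using i(3) by (auto intro!: card_mono finite_breaks breaks_mono)
      ultimately have r: "?r ?j = ?r ?k" "?r (Suc ?j) = ?r ?k" by simp_all
      have "level w ?j = level w (Suc ?j)"
        using not_break[OF r(1), of "Suc ?j"] in\<sigma>[OF i(1)] i(3) by simp
      then have "run_key w ?j < run_key w (Suc ?j)" "run_key w (Suc ?j) < run_key w ?k"
        using r i(3) \<open>level w ?j = level w ?k\<close> by (auto simp: run_key_def)
      moreover have "Suc ?j \<in> {1..n}" using in\<sigma>[OF i(2)] i(3) by auto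
      ultimately have "i < \<tau> (Suc ?j)" "\<tau> (Suc ?j) < Suc i"
        using iff in\<sigma> i(1,2) \<tau>\<sigma> by metis+
      then show False by simp
    qed
    with level_le[OF in\<sigma>[OF i(2)]] i show ?thesis by (auto simp: b_def)
  qed
  moreover have "b 1 < b 0" if "\<sigma> 1 \<noteq> 1"
  proof -
    have 1: "1 \<in> {1..n}" using permutes_not_in[OF \<sigma>, of 1] that by auto
    have "level w (\<sigma> 1) \<noteq> 0"
    proof
      \<comment> \<open>Letter 0 can be entered only from 0, so the walk is all zeros up to the
        value \<open>\<sigma> 1\<close>. There are no breaks so far, and the smaller value 1 would
        be sorted before \<open>\<sigma> 1\<close>, which is first.\<close>
      assume "level w (\<sigma> 1) = 0"
      then have "w ! (\<sigma> 1 - 1) = 0" by (simp add: level_def)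
      moreover have "\<sigma> 1 - 1 < length w" using in\<sigma>[OF 1] w(2) by auto
      ultimately have zero: "w ! k = 0" if "k < \<sigma> 1" for k
        using walk_to_0[OF walk, of "\<sigma> 1 - 1" k] that by auto
      then have "breaks w (\<sigma> 1) = {}" "breaks w 1 = {}" by (auto simp: breaks_def level_def)
      then have "run_key w 1 < run_key w (\<sigma> 1)"
        using zero[of 0] zero[of "\<sigma> 1 - 1"] in\<sigma>[OF 1] that by (auto simp: run_key_def level_def)
      then have "\<tau> 1 < 1" using iff[OF 1 in\<sigma>[OF 1]] \<tau>\<sigma> by metis
      moreover have "\<tau> 1 \<in> {1..n}" using permutes_in_image[OF \<tau>] 1 by blast
      ultimately show False by simp
    qed
    with level_le[OF in\<sigma>[OF 1]] 1 show ?thesis by (auto simp: b_def)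
  qed
  ultimately have "b \<in> compat n M (gaps n \<sigma>)"
    by (auto simp: compat_def b_def gaps_def)
  moreover have "ides_word n M \<tau> b = w"
  proof (rule nth_equalityI)
    show "length (ides_word n M \<tau> b) = length w" by (simp add: ides_word_def w(2))
    fix i assume "i < length (ides_word n M \<tau> b)"
    then have j: "Suc i \<in> {1..n}" by (simp add: ides_word_def del: upt_Suc)
    have "\<tau> (Suc i) \<in> {1..n}" using permutes_in_image[OF \<tau>] j by blast
    then have "M - b (\<tau> (Suc i)) = level w (Suc i)" using level_le[OF j] by (auto simp: b_def \<sigma>\<tau>)
    then show "ides_word n M \<tau> b ! i = w ! i"
      using nth_map_upt1[OF j, of "\<lambda>j. 2 * (M - b (\<tau> j)) - of_bool (2 \<le> j \<and> \<tau> j < \<tau> (j - 1))"]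
        code[of "Suc i"] par[OF j] unfolding ides_word_def by (simp del: upt_Suc)
  qed
  ultimately show ?thesis using \<sigma> inv\<sigma> by metis
qed

lemma ides_word_inj:
  assumes "\<sigma> permutes {1..n}" "b \<in> compat n M (gaps n \<sigma>)"
    and "\<sigma>' permutes {1..n}" "b' \<in> compat n M (gaps n \<sigma>')"
    and eq: "ides_word n M (inv \<sigma>) b = ides_word n M (inv \<sigma>') b'"
  shows "\<sigma> = \<sigma>' \<and> b = b'"
proof -
  have "inv \<sigma> = inv \<sigma>'" using rank_ides_word[OF assms(1,2)] rank_ides_word[OF assms(3,4)] eq by simp
  then have \<sigma>: "\<sigma> = \<sigma>'" using permutes_inv_inv assms(1,3) by metis
  have "M - b i = M - b' i" if i: "i \<in> {1..n}" for i
  proof -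
    have "\<sigma> i \<in> {1..n}" using permutes_in_image[OF assms(1)] i by blast
    from level_ides_word[OF assms(1,2) this] level_ides_word[OF assms(3,4), of "\<sigma> i"] this
    show ?thesis using permutes_inverses(2)[OF assms(1)] eq \<sigma> by simp
  qed
  from compat_eqI[OF assms(2,4) this] \<sigma> show ?thesis by simp
qed

lemma bij_betw_ides_word:
  "bij_betw (\<lambda>(\<sigma>, b). ides_word n M (inv \<sigma>) b) (SIGMA \<sigma>:sym_perms n. compat n M (gaps n \<sigma>))
     {w \<in> walks (Suc (2 * M)). length w = n}"
  unfolding bij_betw_def
proof
  show "inj_on (\<lambda>(\<sigma>, b). ides_word n M (inv \<sigma>) b) (SIGMA \<sigma>:sym_perms n. compat n M (gaps n \<sigma>))"
    using ides_word_inj by (auto simp: inj_on_def sym_perms_def)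
  show "(\<lambda>(\<sigma>, b). ides_word n M (inv \<sigma>) b) ` (SIGMA \<sigma>:sym_perms n. compat n M (gaps n \<sigma>))
      = {w \<in> walks (Suc (2 * M)). length w = n}"
  proof (intro equalityI subsetI)
    fix w assume "w \<in> {w \<in> walks (Suc (2 * M)). length w = n}"
    then have "w \<in> walks (Suc (2 * M))" "length w = n" by auto
    from ides_word_surj[OF this]
    show "w \<in> (\<lambda>(\<sigma>, b). ides_word n M (inv \<sigma>) b) ` (SIGMA \<sigma>:sym_perms n. compat n M (gaps n \<sigma>))"
      by (auto simp: sym_perms_def image_def)
  next
    fix w assume "w \<in> (\<lambda>(\<sigma>, b). ides_word n M (inv \<sigma>) b) ` (SIGMA \<sigma>:sym_perms n. compat n M (gaps n \<sigma>))"
    then obtain \<sigma> b where "\<sigma> permutes {1..n}" "b \<in> compat n M (gaps n \<sigma>)" "w = ides_word n M (inv \<sigma>) b"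
      by (auto simp: sym_perms_def)
    then show "w \<in> {w \<in> walks (Suc (2 * M)). length w = n}"
      using ides_word_mem by blast
  qed
qed

section \<open>Generating functions\<close>

text \<open>The least sequence that is strict at \<open>D\<close>; subtracting it removes the
  strictness. An element 0 of \<open>D\<close> adds 1 to its initial value \<open>card D\<close> but
  nothing to its sum over \<open>{1..n}\<close>, just as a first value other than 1 raises
  \<open>asc2_tilde\<close> and leaves \<open>amaj2\<close> alone.\<close>

definition offset :: "nat set \<Rightarrow> nat \<Rightarrow> nat" where
  "offset D i = card {d \<in> D. i \<le> d}"

text \<open>The Gaussian binomial coefficient of \<open>M + n\<close> over \<open>n\<close> in
  \<open>q\<close>: partitions in an \<open>n\<close> by \<open>M\<close> box.\<close>

definition partition_sum :: "nat \<Rightarrow> nat \<Rightarrow> laurent" where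
  "partition_sum n M = (\<Sum>b\<in>compat n M {}. qpt (\<Sum>i=1..n. int (b i)) 0 0)"

lemma offset_Suc:
  assumes "finite D"
  shows "offset D i = offset D (Suc i) + of_bool (i \<in> D)"
proof -
  have "{d \<in> D. i \<le> d} = (if i \<in> D then insert i {d \<in> D. Suc i \<le> d} else {d \<in> D. Suc i \<le> d})"
    by (auto simp: Suc_le_eq le_less)
  then show ?thesis using assms by (simp add: offset_def)
qed

lemma offset_0: "offset D 0 = card D"
  by (simp add: offset_def)

lemma offset_eq_0: "D \<subseteq> {..<n} \<Longrightarrow> n \<le> i \<Longrightarrow> offset D i = 0"
  unfolding offset_def by (rule card_eq_0_iff[THEN iffD2]) force

lemma sum_offset:
  assumes "D \<subseteq> {..<n}"
  shows "(\<Sum>i=1..n. offset D i) = \<Sum>D"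
proof -
  have fin: "finite D" using assms finite_subset by blast
  have "(\<Sum>i=1..n. offset D i) = (\<Sum>i=1..n. \<Sum>d\<in>D. of_bool (i \<le> d))"
    using fin by (simp add: offset_def sum.If_cases of_bool_def Int_def)
  also have "\<dots> = (\<Sum>d\<in>D. \<Sum>i=1..n. of_bool (i \<le> d))" by (rule sum.swap)
  also have "\<dots> = (\<Sum>d\<in>D. card {1..d})"
  proof (rule sum.cong)
    fix d assume "d \<in> D"
    then have "{1..n} \<inter> {i. i \<le> d} = {1..d}" using assms by auto
    then show "(\<Sum>i=1..n. of_bool (i \<le> d)) = card {1..d}" by (simp add: of_bool_def sum.If_cases)
  qed simp
  finally show ?thesis by simp
qed

lemma offset_le_compat:
  assumes "b \<in> compat n M D" "D \<subseteq> {..<n}"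
  shows "offset D i \<le> b i"
proof (cases "i \<le> n")
  case True
  then show ?thesis
  proof (induction i rule: inc_induct)
    case base
    then show ?case using offset_eq_0[OF assms(2)] by simp
  next
    case (step i)
    have "b (Suc i) + of_bool (i \<in> D) \<le> b i"
      using assms(1) step.hyps by (auto simp: compat_def Suc_le_eq)
    then show ?case using step.IH offset_Suc[of D i] finite_subset[OF assms(2)] by auto
  qed
qed (use offset_eq_0[OF assms(2)] in simp)

lemma finite_compat: "finite (compat n M D)"
proof (rule finite_imageD)
  show "finite ((\<lambda>b. map b [0..<Suc n]) ` compat n M D)"
  proof (rule finite_subset)
    show "(\<lambda>b. map b [0..<Suc n]) ` compat n M D \<subseteq> {xs. set xs \<subseteq> {..M} \<and> length xs = Suc n}"
      using compat_le by (auto simp del: upt_Suc)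
  qed (rule finite_lists_length_eq[OF finite_atMost])
  show "inj_on (\<lambda>b. map b [0..<Suc n]) (compat n M D)"
  proof (intro inj_onI ext)
    fix b b' i assume *: "b \<in> compat n M D" "b' \<in> compat n M D" "map b [0..<Suc n] = map b' [0..<Suc n]"
    then show "b i = b' i"
      by (cases "i \<le> n") (auto simp: compat_def map_eq_conv simp del: upt_Suc)
  qed
qed

lemma bij_betw_compat:
  assumes "D \<subseteq> {..<n}" "card D \<le> M"
  shows "bij_betw (\<lambda>b i. b i + offset D i) (compat n (M - card D) {}) (compat n M D)"
proof (rule bij_betw_byWitness[where f' = "\<lambda>b i. b i - offset D i"])
  have fin: "finite D" using assms finite_subset by blast
  note off = offset_Suc[OF fin] offset_0 offset_eq_0[OF assms(1)]
  show "\<forall>b\<in>compat n (M - card D) {}. (\<lambda>i. b i + offset D i - offset D i) = b" by simp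
  show "\<forall>b\<in>compat n M D. (\<lambda>i. b i - offset D i + offset D i) = b"
    using offset_le_compat[OF _ assms(1)] by simp
  have "(\<lambda>i. b i + offset D i) \<in> compat n M D" if b: "b \<in> compat n (M - card D) {}" for b
  proof -
    have "b (Suc i) + offset D (Suc i) + of_bool (i \<in> D) \<le> b i + offset D i" for i
      using off(1)[of i] compat_antimono[OF b, of i "Suc i"] by simp
    note le = this
    have "b (Suc i) + offset D (Suc i) < b i + offset D i" if "i \<in> D" for i
      using le[of i] that by simp
    moreover have "b (Suc i) + offset D (Suc i) \<le> b i + offset D i" for i
      using le[of i] by linarith
    ultimately show ?thesis using b assms off(2,3) by (auto simp: compat_def)
  qed
  then show "(\<lambda>b i. b i + offset D i) ` compat n (M - card D) {} \<subseteq> compat n M D" by blast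
  have "(\<lambda>i. b i - offset D i) \<in> compat n (M - card D) {}" if b: "b \<in> compat n M D" for b
  proof -
    have "b (Suc i) - offset D (Suc i) \<le> b i - offset D i" for i
    proof -
      have "b (Suc i) + of_bool (i \<in> D) \<le> b i"
        using b compat_antimono[OF b, of i "Suc i"] by (auto simp: compat_def Suc_le_eq)
      then show ?thesis using off(1)[of i] by simp
    qed
    then show ?thesis using b off(2) by (auto simp: compat_def)
  qed
  then show "(\<lambda>b i. b i - offset D i) ` compat n M D \<subseteq> compat n (M - card D) {}" by blast
qed

lemma sum_compat:
  assumes "D \<subseteq> {..<n}"
  shows "(\<Sum>b\<in>compat n M D. qpt ((\<Sum>i=1..n. int (b i)) + e) 0 f)
       = (if card D \<le> M then qpt (int (\<Sum>D) + e) 0 f * partition_sum n (M - card D) else 0)"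
proof (cases "card D \<le> M")
  case True
  have sum: "(\<Sum>i=1..n. int (b i + offset D i)) = (\<Sum>i=1..n. int (b i)) + int (\<Sum>D)" for b
    by (simp add: sum.distrib flip: sum_offset[OF assms])
  have "(\<Sum>b\<in>compat n M D. qpt ((\<Sum>i=1..n. int (b i)) + e) 0 f)
      = (\<Sum>b\<in>compat n (M - card D) {}. qpt ((\<Sum>i=1..n. int (b i + offset D i)) + e) 0 f)"
    by (rule sum.reindex_bij_betw[OF bij_betw_compat[OF assms True], symmetric])
  also have "\<dots> = (\<Sum>b\<in>compat n (M - card D) {}. qpt (int (\<Sum>D) + e) 0 f * qpt (\<Sum>i=1..n. int (b i)) 0 0)"
    unfolding sum qpt_mult by (simp add: algebra_simps)
  finally show ?thesis using True by (simp only: partition_sum_def sum_distrib_left if_True)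
next
  case False
  have "compat n M D = {}"
  proof (rule ccontr)
    assume "compat n M D \<noteq> {}"
    then obtain b where "b \<in> compat n M D" by auto
    then have "card D \<le> M" using offset_le_compat[OF _ assms, of b M 0] offset_0[of D]
      by (simp add: compat_def)
    with False show False by simp
  qed
  with False show ?thesis by simp
qed

lemma partition_sum_0: "partition_sum n 0 = 1"
proof -
  have "b = (\<lambda>_. 0)" if "b \<in> compat n 0 {}" for b
    using compat_le[OF that] by auto
  moreover have "(\<lambda>_. 0) \<in> compat n 0 {}" by (simp add: compat_def)
  ultimately have "compat n 0 {} = {\<lambda>_. 0}" by blast
  then show ?thesis by (simp add: partition_sum_def qpt_zero)
qed

text \<open>Triangularity: as \<open>h 0 = 1\<close>, convolution with \<open>h\<close> is injective.\<close>

lemma convolution_cancel: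
  fixes h :: "nat \<Rightarrow> 'a::comm_ring_1"
  assumes "finite A" "h 0 = 1"
    and eq: "\<And>M. (\<Sum>x\<in>A. if s x \<le> M then u x * h (M - s x) else 0)
                = (\<Sum>x\<in>A. if s' x \<le> M then u' x * h (M - s' x) else 0)"
  shows "(\<Sum>x\<in>{x\<in>A. s x = k}. u x) = (\<Sum>x\<in>{x\<in>A. s' x = k}. u' x)"
proof (induction k rule: less_induct)
  case (less k)
  have group: "(\<Sum>x\<in>A. if s x \<le> k then u x * h (k - s x) else 0)
      = (\<Sum>x\<in>{x\<in>A. s x = k}. u x) + (\<Sum>m<k. (\<Sum>x\<in>{x\<in>A. s x = m}. u x) * h (k - m))"
    for s :: "_ \<Rightarrow> nat" and u
  proof -
    have "(\<Sum>x\<in>A. if s x \<le> k then u x * h (k - s x) else 0) = (\<Sum>x\<in>{x\<in>A. s x \<le> k}. u x * h (k - s x))"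
      by (simp add: sum.inter_filter assms(1))
    also have "\<dots> = (\<Sum>m\<in>{..k}. \<Sum>x\<in>{x \<in> {x\<in>A. s x \<le> k}. s x = m}. u x * h (k - s x))"
      by (rule sum.group[symmetric]) (use assms(1) in auto)
    also have "\<dots> = (\<Sum>m\<in>{..k}. (\<Sum>x\<in>{x\<in>A. s x = m}. u x) * h (k - m))"
      unfolding sum_distrib_right by (intro sum.cong) auto
    finally show ?thesis using assms(2) by (simp add: add.commute flip: lessThan_Suc_atMost)
  qed
  \<comment> \<open>At \<open>M = k\<close> the groups below \<open>k\<close> agree by induction,
    and the group of \<open>k\<close> itself has the factor \<open>h 0 = 1\<close>.\<close>
  from eq[of k] less.IH show ?case unfolding group by simp
qed

section \<open>Weights of words and comparison of the two sums\<close>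

definition word_weight :: "nat \<Rightarrow> nat list \<Rightarrow> laurent" where
  "word_weight M w = qpt (\<Sum>a\<leftarrow>w. int M - int (Suc a div 2)) 0 (\<Sum>a\<leftarrow>w. of_bool (odd a))"

lemma word_weight_mset: "mset v = mset w \<Longrightarrow> word_weight M v = word_weight M w"
proof -
  have "sum_list (map g xs) = sum_mset (image_mset g (mset xs))" for xs and g :: "nat \<Rightarrow> int"
    by (simp flip: mset_map add: sum_mset_sum_list)
  then show "mset v = mset w \<Longrightarrow> word_weight M v = word_weight M w"
    by (simp add: word_weight_def)
qed

text \<open>Words are indexed by values but \<open>b\<close> by positions; \<open>\<sigma>\<close>
  translates between the two.\<close>

lemma sum_word:
  fixes g :: "nat \<Rightarrow> int"
  assumes "\<sigma> permutes {1..n}" and "length w = n"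
  shows "(\<Sum>a\<leftarrow>w. g a) = (\<Sum>i=1..n. g (w ! (\<sigma> i - 1)))"
proof -
  have "(\<Sum>a\<leftarrow>w. g a) = (\<Sum>i<n. g (w ! i))"
    using assms(2) by (simp add: sum_list_sum_nth atLeast0LessThan)
  also have "\<dots> = (\<Sum>i=1..n. g (w ! (i - 1)))"
    by (rule sum.reindex_bij_witness[of _ "\<lambda>i. i - 1" Suc]) auto
  also have "\<dots> = (\<Sum>i=1..n. g (w ! (\<sigma> i - 1)))"
    by (rule sum.permute[OF assms(1), unfolded comp_def])
  finally show ?thesis .
qed

lemma int_exc: "int (exc n \<sigma>) = (\<Sum>i=1..n. of_bool (i < \<sigma> i))"
  by (simp add: exc_def of_bool_def sum.If_cases Int_def)

lemma word_weight_exc_word: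
  assumes "\<sigma> permutes {1..n}" "b \<in> compat n M (DES n \<sigma>)"
  shows "word_weight M (exc_word n M \<sigma> b)
    = qpt ((\<Sum>i=1..n. int (b i)) + - int (exc n \<sigma>)) 0 (int (exc n \<sigma>))"
proof -
  let ?w = "exc_word n M \<sigma> b"
  have len: "length ?w = n" by (simp add: exc_word_def)
  have "(\<Sum>a\<leftarrow>?w. int M - int (Suc a div 2)) = (\<Sum>i=1..n. int (b i) - of_bool (i < \<sigma> i))"
    unfolding sum_word[OF assms(1) len]
  proof (intro sum.cong refl)
    fix i assume "i \<in> {1..n}"
    then show "int M - int (Suc (?w ! (\<sigma> i - 1)) div 2) = int (b i) - of_bool (i < \<sigma> i)"
      using compat_le[OF assms(2), of i] unfolding nth_exc_word[OF assms(1) \<open>i \<in> {1..n}\<close>]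
      by (simp add: exc_code_def of_nat_diff)
  qed
  moreover have "(\<Sum>a\<leftarrow>?w. of_bool (odd a)) = int (exc n \<sigma>)"
    unfolding sum_word[OF assms(1) len] int_exc
  proof (intro sum.cong refl)
    fix i assume i: "i \<in> {1..n}"
    show "of_bool (odd (?w ! (\<sigma> i - 1))) = of_bool (i < \<sigma> i)"
      unfolding nth_exc_word[OF assms(1) i] by (simp add: exc_code_def)
  qed
  ultimately show ?thesis unfolding word_weight_def int_exc by (simp add: sum_subtractf)
qed

lemma int_des: "int (des n \<tau>) = (\<Sum>j=1..n. of_bool (2 \<le> j \<and> \<tau> j < \<tau> (j - 1)))"
proof -
  have "int (des n \<tau>) = (\<Sum>i=1..n - 1. of_bool (\<tau> (Suc i) < \<tau> i))"
    by (simp add: des_def DES_def of_bool_def sum.If_cases Int_def)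
  also have "\<dots> = (\<Sum>j=2..n. of_bool (\<tau> j < \<tau> (j - 1)))"
    by (rule sum.reindex_bij_witness[of _ "\<lambda>i. i - 1" Suc]) auto
  also have "\<dots> = (\<Sum>j=1..n. of_bool (2 \<le> j \<and> \<tau> j < \<tau> (j - 1)))"
    by (rule sum.mono_neutral_cong_left) auto
  finally show ?thesis .
qed

lemma word_weight_ides_word:
  assumes "\<sigma> permutes {1..n}" "b \<in> compat n M (gaps n \<sigma>)"
  shows "word_weight M (ides_word n M (inv \<sigma>) b)
    = qpt ((\<Sum>i=1..n. int (b i)) + 0) 0 (int (des n (inv \<sigma>)))"
proof -
  let ?w = "ides_word n M (inv \<sigma>) b"
  have len: "length ?w = n" by (simp add: ides_word_def)
  have in\<sigma>: "\<sigma> i \<in> {1..n}" if "i \<in> {1..n}" for i using permutes_in_image[OF assms(1)] that by blast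
  have "(\<Sum>a\<leftarrow>?w. int M - int (Suc a div 2)) = (\<Sum>i=1..n. int (b i))"
    unfolding sum_word[OF assms(1) len]
  proof (intro sum.cong refl)
    fix i assume "i \<in> {1..n}"
    from level_ides_word[OF assms in\<sigma>[OF this]]
    show "int M - int (Suc (?w ! (\<sigma> i - 1)) div 2) = int (b i)"
      using compat_le[OF assms(2), of i] permutes_inverses(2)[OF assms(1), of i]
      by (simp add: level_def of_nat_diff)
  qed
  moreover have "(\<Sum>a\<leftarrow>?w. of_bool (odd a)) = int (des n (inv \<sigma>))"
    unfolding sum_word[OF permutes_id len] int_des
    using odd_ides_word[OF assms] by (intro sum.cong refl) (simp only: id_apply)
  ultimately show ?thesis unfolding word_weight_def by simp
qed

lemma finite_sym_perms: "finite (sym_perms n)"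
  unfolding sym_perms_def by (simp add: finite_permutations)

lemma compat_sums_eq:
  "(\<Sum>\<sigma>\<in>sym_perms n. \<Sum>b\<in>compat n M (gaps n \<sigma>). qpt ((\<Sum>i=1..n. int (b i)) + 0) 0 (int (des n (inv \<sigma>))))
   = (\<Sum>\<sigma>\<in>sym_perms n. \<Sum>b\<in>compat n M (DES n \<sigma>).
        qpt ((\<Sum>i=1..n. int (b i)) + - int (exc n \<sigma>)) 0 (int (exc n \<sigma>)))"
  (is "?L = ?R")
proof -
  let ?W = "{w \<in> walks (Suc (2 * M)). length w = n}"
  obtain f where f: "bij_betw f (rearrangements n (Suc (2 * M))) ?W"
    and mset: "\<forall>v\<in>rearrangements n (Suc (2 * M)). mset (f v) = mset v"
    using rearrangements_walks_bij by blast
  have "?L = (\<Sum>(\<sigma>, b)\<in>(SIGMA \<sigma>:sym_perms n. compat n M (gaps n \<sigma>)). word_weight M (ides_word n M (inv \<sigma>) b))"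
    by (subst sum.Sigma[symmetric])
       (auto simp: finite_permutations finite_compat sym_perms_def word_weight_ides_word intro!: sum.cong)
  also have "\<dots> = (\<Sum>w\<in>?W. word_weight M w)"
    using sum.reindex_bij_betw[OF bij_betw_ides_word[of n M], of "word_weight M"]
    by (simp add: case_prod_unfold)
  also have "\<dots> = (\<Sum>v\<in>rearrangements n (Suc (2 * M)). word_weight M (f v))"
    by (rule sum.reindex_bij_betw[OF f, symmetric])
  also have "\<dots> = (\<Sum>v\<in>rearrangements n (Suc (2 * M)). word_weight M v)"
    using mset by (intro sum.cong refl word_weight_mset) blast
  also have "\<dots> = (\<Sum>(\<sigma>, b)\<in>(SIGMA \<sigma>:sym_perms n. compat n M (DES n \<sigma>)). word_weight M (exc_word n M \<sigma> b))"
    using sum.reindex_bij_betw[OF bij_betw_exc_word[of n M], of "word_weight M"]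
    by (simp add: case_prod_unfold)
  also have "\<dots> = ?R"
    by (subst sum.Sigma[symmetric])
       (auto simp: finite_permutations finite_compat sym_perms_def word_weight_exc_word intro!: sum.cong)
  finally show ?thesis .
qed

lemma gaps_subset: "1 \<le> n \<Longrightarrow> gaps n \<sigma> \<subseteq> {..<n}"
  by (auto simp: gaps_def ASC2_def)

lemma card_gaps: "card (gaps n \<sigma>) = asc2_tilde n \<sigma>"
  and sum_gaps: "\<Sum>(gaps n \<sigma>) = amaj2 n \<sigma>"
proof -
  have "finite (ASC2 n \<sigma>)" "0 \<notin> ASC2 n \<sigma>" by (auto simp: ASC2_def)
  then show "card (gaps n \<sigma>) = asc2_tilde n \<sigma>" "\<Sum>(gaps n \<sigma>) = amaj2 n \<sigma>"
    by (simp_all add: gaps_def asc2_tilde_def asc2_def amaj2_def)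
qed

lemma DES_subset: "DES n \<sigma> \<subseteq> {..<n}"
  by (auto simp: DES_def)

theorem theorem4p1:
  fixes n :: nat
  assumes "n \<ge> 1"
  shows "(\<Sum>\<sigma> \<in> sym_perms n.
            qpt (int (amaj2 n \<sigma>)) (int (asc2_tilde n \<sigma>)) (int (des n (inv \<sigma>))))
       = (\<Sum>\<sigma> \<in> sym_perms n.
            qpt (int (maj n \<sigma>) - int (exc n \<sigma>)) (int (des n \<sigma>)) (int (exc n \<sigma>)))"
proof -
  let ?l = "\<lambda>\<sigma>. qpt (int (amaj2 n \<sigma>)) 0 (int (des n (inv \<sigma>)))"
  let ?r = "\<lambda>\<sigma>. qpt (int (maj n \<sigma>) - int (exc n \<sigma>)) 0 (int (exc n \<sigma>))"
  have "(\<Sum>\<sigma>\<in>sym_perms n. if asc2_tilde n \<sigma> \<le> M then ?l \<sigma> * partition_sum n (M - asc2_tilde n \<sigma>) else 0)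
      = (\<Sum>\<sigma>\<in>sym_perms n. if des n \<sigma> \<le> M then ?r \<sigma> * partition_sum n (M - des n \<sigma>) else 0)" for M
    using compat_sums_eq[where n = n and M = M]
    unfolding sum_compat[OF gaps_subset[OF assms]] sum_compat[OF DES_subset] card_gaps sum_gaps
      des_def[symmetric] maj_def[symmetric]
    by (simp cong: if_cong)
  \<comment> \<open>The degrees cancelled here are the two exponents of \<open>p\<close>, while
    \<open>?l\<close> and \<open>?r\<close> keep only \<open>q\<close> and \<open>t\<close>; this is
    equality of the coefficients of each power of \<open>p\<close>.\<close>
  note coeff = convolution_cancel[OF finite_sym_perms partition_sum_0 this]
  have group: "(\<Sum>\<sigma>\<in>sym_perms n. u \<sigma> * qpt 0 (int (s \<sigma>)) 0)
      = (\<Sum>k\<in>K. (\<Sum>\<sigma>\<in>{\<sigma>\<in>sym_perms n. s \<sigma> = k}. u \<sigma>) * qpt 0 (int k) 0)"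
    if "finite K" "s ` sym_perms n \<subseteq> K" for K s and u :: "_ \<Rightarrow> laurent"
  proof -
    have "(\<Sum>\<sigma>\<in>sym_perms n. u \<sigma> * qpt 0 (int (s \<sigma>)) 0)
        = (\<Sum>k\<in>K. \<Sum>\<sigma>\<in>{\<sigma>\<in>sym_perms n. s \<sigma> = k}. u \<sigma> * qpt 0 (int (s \<sigma>)) 0)"
      by (rule sum.group[OF finite_sym_perms that, symmetric])
    then show ?thesis unfolding sum_distrib_right by simp
  qed
  \<comment> \<open>A common finite index set for both sides, so that the two groupings can be
    compared term by term.\<close>
  let ?K = "asc2_tilde n ` sym_perms n \<union> des n ` sym_perms n"
  have "(\<Sum>\<sigma>\<in>sym_perms n. ?l \<sigma> * qpt 0 (int (asc2_tilde n \<sigma>)) 0)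
      = (\<Sum>\<sigma>\<in>sym_perms n. ?r \<sigma> * qpt 0 (int (des n \<sigma>)) 0)"
    using finite_sym_perms by (subst (1 2) group[of ?K]) (auto simp: coeff)
  then show ?thesis by (simp add: qpt_mult)
qed

end
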